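(* Let $\Omega=(0,1)^d$, let $\sigma_1,\sigma_2$ be activation functions and let $\varphi_1,\varphi_2$ be norm functions for $\sigma_1,\sigma_2$ respectively. For $f\in B_{\sigma_2}^{\varphi_2}$, a measure $\rho\in\mathcal{M}^{\varphi_2}(\mathbb{R}^{d+1})$ and a constant $M>0$, say that $(f,\rho,M)$ satisfies the assumptions (A) if: (i) $f(x)=\int_{\mathbb{R}^{d+1}}\sigma_2(w\cdot x+b)\,\mathrm{d}\rho(w,b)$ for $x\in\Omega$; (ii) there is a finite signed complex kernel $(w,b)\mapsto\mu_{(w,b)}$ from $\mathbb{R}^{d+1}$ to itself such that for every $(w,b)\in\operatorname{supp}\rho$ and $x\in\Omega$, $$\sigma_2(w\cdot x+b)=\int_{\mathbb{R}^{d+1}}\sigma_1(\omega\cdot x+\beta)\,\mathrm{d}\mu_{(w,b)}(\omega,\beta);$$ (iii) for all $(w,b)\in\operatorname{supp}\rho$, $$\int_{\mathbb{R}^{d+1}}\varphi_1(\|\omega\|_1+|\beta|)\,\mathrm{d}|\mu_{(w,b)}|(\omega,\beta)\le M\,\varphi_2(\|w\|_1+|b|),$$ with $M$ independent of $(w,b)$. Then: (1) If $(f,\rho,M)$ satisfies (A), there exists a finite signed complex Radon measure $\nu$ on $\mathbb{R}^{d+1}$ such that $f(x)=\int_{\mathbb{R}^{d+1}}\sigma_1(\omega\cdot x+\beta)\,\mathrm{d}\nu(\omega,\beta)$ for $x\in\Omega$ and $\|f\|_{B_{\sigma_1,\nu}^{\varphi_1}}\le M\,\|f\|_{B_{\sigma_2,\rho}^{\varphi_2}}$.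 Consequently $f\in B_{\sigma_1}^{\varphi_1}$ and $\|f\|_{B_{\sigma_1}^{\varphi_1}}\le M\|f\|_{B_{\sigma_2,\rho}^{\varphi_2}}$. (2) If there is a sequence $\{\rho_n\}_{n\in\mathbb{N}}$ of representing measures of $f$ with $\|f\|_{B_{\sigma_2,\rho_n}^{\varphi_2}}\to\|f\|_{B_{\sigma_2}^{\varphi_2}}$ and such that $(f,\rho_n,M)$ satisfies (A) for each $n$ with the same constant $M$, then $\|f\|_{B_{\sigma_1}^{\varphi_1}}\le M\|f\|_{B_{\sigma_2}^{\varphi_2}}$. (3) If every $f\in B_{\sigma_2}^{\varphi_2}$ admits a sequence as in (2) with a constant $M$ independent of both $f$ and $n$, then $B_{\sigma_2}^{\varphi_2}\hookrightarrow B_{\sigma_1}^{\varphi_1}$ continuously, with embedding norm at most $M$.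
   Context: An activation function is a Borel-measurable map $\sigma:\mathbb{R}\to\mathbb{C}$. A function $\varphi:[0,\infty)\to(0,\infty)$ is a norm function for $\sigma$ if $\varphi$ is (positive and) non-decreasing and there is a constant $C>0$ with $|\sigma(x)|\le C\varphi(|x|)$ for all $x\in\mathbb{R}$. Points of $\mathbb{R}^{d+1}$ are written $(w,b)$ or $(\omega,\beta)$ with first component in $\mathbb{R}^d$ and second in $\mathbb{R}$; $|\rho|$ denotes total variation. Put $\mathcal{M}^\varphi(\mathbb{R}^{d+1})=\{\rho \text{ finite complex Radon measure on }\mathbb{R}^{d+1}:\int\varphi(\|w\|_1+|b|)\,\mathrm{d}|\rho|<\infty\}$. The generalized Barron space $B_\sigma^\varphi=B_\sigma^\varphi(\Omega)$ is the set of measurable $f:\Omega\to\mathbb{C}$ (identified when equal a.e.) for which there is $\rho\in\mathcal{M}^\varphi(\mathbb{R}^{d+1})$ with $f(x)=\int_{\mathbb{R}^{d+1}}\sigma(w\cdot x+b)\,\mathrm{d}\rho(w,b)$ for a.e. $x\in\Omega$ (a representing measure of $f$). For a representing measure write $\|f\|_{B_{\sigma,\rho}^\varphi}=\int_{\mathbb{R}^{d+1}}\varphi(\|w\|_1+|b|)\,\mathrm{d}|\rho|$, and $\|f\|_{B_\sigma^\varphi}=\inf_\rho\|f\|_{B_{\sigma,\rho}^\varphi}$ over all representing measures in $\mathcal{M}^\varphi(\mathbb{R}^{d+1})$. A finite signed complex kernel from a measurable space $(X,\mathscr{A})$ to $(Y,\mathscr{B})$ is a map $K:X\times\mathscr{B}\to\mathbb{C}$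 such that $B\mapsto K(x,B)$ is a finite complex measure for each $x\in X$, $x\mapsto K(x,B)$ is $\mathscr{A}$-measurable for each $B\in\mathscr{B}$, and, with $|K|(x,\cdot)$ the total variation of $K(x,\cdot)$, $x\mapsto|K|(x,B)$ is measurable for each $B\in\mathscr{B}$. Here $X=Y=\mathbb{R}^{d+1}$ with Borel $\sigma$-algebras and $\mu_{(w,b)}=K((w,b),\cdot)$. *)

theory Defs
  imports "HOL-Analysis.Analysis"
begin

section \<open>Complex measures\<close>

text \<open>A complex measure on the measurable space \<open>M\<close> is a set function; its values outside
  \<^term>\<open>sets M\<close> are irrelevant. As all values are complex numbers, such a measure is automatically
  finite, i.e. its total variation is finite.\<close>

definition complex_measure :: "'a measure \<Rightarrow> ('a set \<Rightarrow> complex) \<Rightarrow> bool" where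
  "complex_measure M \<mu> \<longleftrightarrow>
     (\<forall>A :: nat \<Rightarrow> 'a set. range A \<subseteq> sets M \<longrightarrow> disjoint_family A \<longrightarrow>
        (\<lambda>i. \<mu> (A i)) sums \<mu> (\<Union>i. A i))"

definition variation :: "'a measure \<Rightarrow> ('a set \<Rightarrow> complex) \<Rightarrow> 'a set \<Rightarrow> ennreal" where
  "variation M \<mu> E =
     (SUP A \<in> {A :: nat \<Rightarrow> 'a set. range A \<subseteq> sets M \<and> disjoint_family A \<and> (\<Union>i. A i) = E}.
        \<Sum>i. ennreal (norm (\<mu> (A i))))"

text \<open>The following is \<open>|\<mu>|\<close> as a library measure. That \<^const>\<open>measure_of\<close> does not fall back to
  its default value is lemma \<open>emeasure_total_variation\<close> below.\<close>

definition total_variation :: "'a measure \<Rightarrow> ('a set \<Rightarrow> complex) \<Rightarrow> 'a measure" where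
  "total_variation M \<mu> = measure_of (space M) (sets M) (variation M \<mu>)"

text \<open>Integration against a complex measure goes through the polar decomposition
  \<open>d\<mu> = h d|\<mu>|\<close> with \<open>|h| = 1\<close>, which exists for every complex measure and is unique up to
  \<open>|\<mu>|\<close>-null sets; \<open>\<integral> f d\<mu> = \<integral> f h d|\<mu>|\<close>.\<close>

definition polar_density :: "'a measure \<Rightarrow> ('a set \<Rightarrow> complex) \<Rightarrow> 'a \<Rightarrow> complex" where
  "polar_density M \<mu> =
     (SOME h. h \<in> borel_measurable M \<and> (\<forall>x\<in>space M. norm (h x) = 1) \<and>
        (\<forall>E\<in>sets M. \<mu> E = (LINT x:E|total_variation M \<mu>. h x)))"

definition complex_integral :: "'a measure \<Rightarrow> ('a set \<Rightarrow> complex) \<Rightarrow> ('a \<Rightarrow> complex) \<Rightarrow> complex" where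
  "complex_integral M \<mu> f = (LINT x|total_variation M \<mu>. f x * polar_density M \<mu> x)"

definition complex_radon_measure :: "('a::topological_space set \<Rightarrow> complex) \<Rightarrow> bool" where
  "complex_radon_measure \<rho> \<longleftrightarrow> complex_measure borel \<rho> \<and>
     (\<forall>B\<in>sets borel. emeasure (total_variation borel \<rho>) B =
        (SUP K\<in>{K. K \<subseteq> B \<and> compact K}. emeasure (total_variation borel \<rho>) K))"

definition complex_measure_support :: "('a::topological_space set \<Rightarrow> complex) \<Rightarrow> 'a set" where
  "complex_measure_support \<rho> =
     {z. \<forall>U. open U \<longrightarrow> z \<in> U \<longrightarrow> emeasure (total_variation borel \<rho>) U > 0}"

definition complex_kernel :: "'a measure \<Rightarrow> 'b measure \<Rightarrow> ('a \<Rightarrow> 'b set \<Rightarrow> complex) \<Rightarrow> bool" where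
  "complex_kernel X Y K \<longleftrightarrow>
     (\<forall>x\<in>space X. complex_measure Y (K x)) \<and>
     (\<forall>B\<in>sets Y. (\<lambda>x. K x B) \<in> borel_measurable X) \<and>
     (\<forall>B\<in>sets Y. (\<lambda>x. emeasure (total_variation Y (K x)) B) \<in> borel_measurable X)"


section \<open>Generalized Barron spaces\<close>

text \<open>\<open>\<real>\<^sup>d\<close> is \<^typ>\<open>real^'d\<close> and \<open>\<real>\<^sup>d\<^sup>+\<^sup>1\<close> is \<^typ>\<open>(real^'d) \<times> real\<close>. Functions on \<open>[0,\<infinity>)\<close> or on \<open>\<Omega>\<close>
  are total functions of which only the values on that set matter.\<close>

definition unit_cube :: "(real^'d) set" where
  "unit_cube = {x. \<forall>i. 0 < x $ i \<and> x $ i < 1}"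

definition activation :: "(real \<Rightarrow> complex) \<Rightarrow> bool" where
  "activation \<sigma> \<longleftrightarrow> \<sigma> \<in> borel_measurable borel"

definition norm_function :: "(real \<Rightarrow> complex) \<Rightarrow> (real \<Rightarrow> real) \<Rightarrow> bool" where
  "norm_function \<sigma> \<phi> \<longleftrightarrow>
     (\<forall>t\<ge>0. \<phi> t > 0) \<and> mono_on {0..} \<phi> \<and> (\<exists>C>0. \<forall>x. norm (\<sigma> x) \<le> C * \<phi> \<bar>x\<bar>)"

definition l1_size :: "(real^'d) \<times> real \<Rightarrow> real" where
  "l1_size z = (\<Sum>i\<in>UNIV. \<bar>fst z $ i\<bar>) + \<bar>snd z\<bar>"

text \<open>\<open>\<integral> \<phi>(\<parallel>w\<parallel>\<^sub>1 + |b|) d|\<rho>|\<close>, which is \<open>\<parallel>f\<parallel>\<close> relative to \<open>\<rho>\<close> if \<open>\<rho>\<close> represents \<open>f\<close>.\<close>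

definition weighted_variation ::
  "(real \<Rightarrow> real) \<Rightarrow> (((real^'d) \<times> real) set \<Rightarrow> complex) \<Rightarrow> ennreal" where
  "weighted_variation \<phi> \<rho> = (\<integral>\<^sup>+ z. ennreal (\<phi> (l1_size z)) \<partial>total_variation borel \<rho>)"

definition weighted_measures ::
  "(real \<Rightarrow> real) \<Rightarrow> (((real^'d) \<times> real) set \<Rightarrow> complex) set" where
  "weighted_measures \<phi> = {\<rho>. complex_radon_measure \<rho> \<and> weighted_variation \<phi> \<rho> < \<infinity>}"

definition network ::
  "(real \<Rightarrow> complex) \<Rightarrow> (((real^'d) \<times> real) set \<Rightarrow> complex) \<Rightarrow> real^'d \<Rightarrow> complex" where
  "network \<sigma> \<rho> x = complex_integral borel \<rho> (\<lambda>(w, b). \<sigma> (w \<bullet> x + b))"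

definition representing_measures ::
  "(real^'d) set \<Rightarrow> (real \<Rightarrow> complex) \<Rightarrow> (real \<Rightarrow> real) \<Rightarrow> (real^'d \<Rightarrow> complex)
     \<Rightarrow> (((real^'d) \<times> real) set \<Rightarrow> complex) set" where
  "representing_measures \<Omega> \<sigma> \<phi> f =
     {\<rho> \<in> weighted_measures \<phi>. AE x in lebesgue_on \<Omega>. f x = network \<sigma> \<rho> x}"

text \<open>Elements of the Barron space are represented by functions; two functions represent the same
  element iff they agree almost everywhere on \<open>\<Omega>\<close>. Membership and norm depend only on that class.
  The norm is \<open>\<infinity>\<close> exactly when there is no representing measure.\<close>

definition barron_space ::
  "(real^'d) set \<Rightarrow> (real \<Rightarrow> complex) \<Rightarrow> (real \<Rightarrow> real) \<Rightarrow> (real^'d \<Rightarrow> complex) set" where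
  "barron_space \<Omega> \<sigma> \<phi> =
     {f \<in> borel_measurable (lebesgue_on \<Omega>). representing_measures \<Omega> \<sigma> \<phi> f \<noteq> {}}"

definition barron_norm ::
  "(real^'d) set \<Rightarrow> (real \<Rightarrow> complex) \<Rightarrow> (real \<Rightarrow> real) \<Rightarrow> (real^'d \<Rightarrow> complex) \<Rightarrow> ennreal" where
  "barron_norm \<Omega> \<sigma> \<phi> f = (INF \<rho>\<in>representing_measures \<Omega> \<sigma> \<phi> f. weighted_variation \<phi> \<rho>)"

text \<open>The inclusion of \<open>V\<close> in \<open>W\<close> as a continuous map, for spaces of functions with norms \<open>p\<close> and
  \<open>q\<close>, and the operator norm of the inclusion.\<close>

definition continuously_embedded ::
  "('a \<Rightarrow> complex) set \<Rightarrow> (('a \<Rightarrow> complex) \<Rightarrow> ennreal) \<Rightarrow>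
   ('a \<Rightarrow> complex) set \<Rightarrow> (('a \<Rightarrow> complex) \<Rightarrow> ennreal) \<Rightarrow> bool" where
  "continuously_embedded V p W q \<longleftrightarrow> V \<subseteq> W \<and>
     (\<forall>f\<in>V. \<forall>g. (\<forall>n::nat. g n \<in> V) \<longrightarrow> (\<lambda>n. p (\<lambda>x. g n x - f x)) \<longlonglongrightarrow> 0 \<longrightarrow>
        (\<lambda>n. q (\<lambda>x. g n x - f x)) \<longlonglongrightarrow> 0)"

definition embedding_norm ::
  "('a \<Rightarrow> complex) set \<Rightarrow> (('a \<Rightarrow> complex) \<Rightarrow> ennreal) \<Rightarrow> (('a \<Rightarrow> complex) \<Rightarrow> ennreal) \<Rightarrow> ennreal" where
  "embedding_norm V p q = (SUP f\<in>{f\<in>V. p f \<le> 1}. q f)"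


section \<open>The assumptions (A)\<close>

definition assumptions_A ::
  "(real^'d) set \<Rightarrow> (real \<Rightarrow> complex) \<Rightarrow> (real \<Rightarrow> real) \<Rightarrow> (real \<Rightarrow> complex) \<Rightarrow> (real \<Rightarrow> real) \<Rightarrow>
   (real^'d \<Rightarrow> complex) \<Rightarrow> (((real^'d) \<times> real) set \<Rightarrow> complex) \<Rightarrow> real \<Rightarrow> bool" where
  "assumptions_A \<Omega> \<sigma>1 \<phi>1 \<sigma>2 \<phi>2 f \<rho> M \<longleftrightarrow>
     f \<in> barron_space \<Omega> \<sigma>2 \<phi>2 \<and> \<rho> \<in> weighted_measures \<phi>2 \<and> M > 0 \<and>
     (\<forall>x\<in>\<Omega>. f x = network \<sigma>2 \<rho> x) \<and>
     (\<exists>K :: (real^'d) \<times> real \<Rightarrow> ((real^'d) \<times> real) set \<Rightarrow> complex.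
        complex_kernel borel borel K \<and>
        (\<forall>(w, b) \<in> complex_measure_support \<rho>.
           \<forall>x\<in>\<Omega>. \<sigma>2 (w \<bullet> x + b) = network \<sigma>1 (K (w, b)) x) \<and>
        (\<forall>(w, b) \<in> complex_measure_support \<rho>.
           weighted_variation \<phi>1 (K (w, b)) \<le> ennreal (M * \<phi>2 (l1_size (w, b)))))"

text \<open>For an element \<open>f\<close> of the Barron space, i.e. an almost-everywhere class, the pointwise
  identity in (A) is a condition on a representative \<open>g\<close>, which may depend on the measure.
  (For a given measure, it fails as soon as \<open>g\<close> is modified at a single point of \<open>\<Omega>\<close>.)\<close>

definition admissible_sequence ::
  "(real^'d) set \<Rightarrow> (real \<Rightarrow> complex) \<Rightarrow> (real \<Rightarrow> real) \<Rightarrow> (real \<Rightarrow> complex) \<Rightarrow> (real \<Rightarrow> real) \<Rightarrow>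
   (real^'d \<Rightarrow> complex) \<Rightarrow> (nat \<Rightarrow> ((real^'d) \<times> real) set \<Rightarrow> complex) \<Rightarrow> real \<Rightarrow> bool" where
  "admissible_sequence \<Omega> \<sigma>1 \<phi>1 \<sigma>2 \<phi>2 f \<rho> M \<longleftrightarrow>
     (\<forall>n. \<rho> n \<in> representing_measures \<Omega> \<sigma>2 \<phi>2 f) \<and>
     (\<lambda>n. weighted_variation \<phi>2 (\<rho> n)) \<longlonglongrightarrow> barron_norm \<Omega> \<sigma>2 \<phi>2 f \<and>
     (\<forall>n. \<exists>g. (AE x in lebesgue_on \<Omega>. g x = f x) \<and> assumptions_A \<Omega> \<sigma>1 \<phi>1 \<sigma>2 \<phi>2 g (\<rho> n) M)"


section \<open>The total variation is a measure\<close>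

lemma variation_ge:
  assumes "range A \<subseteq> sets M" "disjoint_family (A :: nat \<Rightarrow> _)" "(\<Union>i. A i) = E"
  shows "(\<Sum>i. ennreal (norm (\<mu> (A i)))) \<le> variation M \<mu> E"
  unfolding variation_def by (rule SUP_upper) (use assms in auto)

lemma complex_measure_empty:
  assumes "complex_measure M \<mu>"
  shows "\<mu> {} = 0"
proof -
  have "(\<lambda>i::nat. \<mu> {}) sums \<mu> {}"
    using assms[unfolded complex_measure_def, rule_format, of "\<lambda>i. {}"]
    by (auto simp: disjoint_family_on_def)
  then have "(\<lambda>i::nat. \<mu> {}) \<longlonglongrightarrow> 0"
    by (intro summable_LIMSEQ_zero sums_summable)
  then show ?thesis by (simp add: LIMSEQ_const_iff)
qed

lemma ennreal_norm_sums_le: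
  fixes z :: "nat \<Rightarrow> complex"
  assumes "z sums s"
  shows "ennreal (norm s) \<le> (\<Sum>i. ennreal (norm (z i)))"
proof (rule LIMSEQ_le_const2)
  show "(\<lambda>n. ennreal (norm (\<Sum>i<n. z i))) \<longlonglongrightarrow> ennreal (norm s)"
    using assms unfolding sums_def by (intro tendsto_ennrealI tendsto_norm)
  have "ennreal (norm (\<Sum>i<n. z i)) \<le> (\<Sum>i. ennreal (norm (z i)))" for n
  proof -
    have "ennreal (norm (\<Sum>i<n. z i)) \<le> ennreal (\<Sum>i<n. norm (z i))"
      by (intro ennreal_leI norm_sum)
    also have "\<dots> = (\<Sum>i<n. ennreal (norm (z i)))" by simp
    also have "\<dots> \<le> (\<Sum>i. ennreal (norm (z i)))" by (rule sum_le_suminf) auto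
    finally show ?thesis .
  qed
  then show "\<exists>N. \<forall>n\<ge>N. ennreal (norm (\<Sum>i<n. z i)) \<le> (\<Sum>i. ennreal (norm (z i)))" by blast
qed

lemma ennreal_suminf_swap:
  "(\<Sum>j. \<Sum>i. f j i) = (\<Sum>i. \<Sum>j. f j i :: ennreal)"
  using nn_integral_fst_count_space[of "\<lambda>(i, j). f i j"]
    nn_integral_snd_count_space[of "\<lambda>(i, j). f i j"]
  by (simp add: nn_integral_count_space_nat)

lemma countably_additive_variation:
  assumes \<mu>: "complex_measure M \<mu>"
  shows "countably_additive (sets M) (variation M \<mu>)"
proof (rule countably_additiveI)
  fix E :: "nat \<Rightarrow> 'a set"
  assume E: "range E \<subseteq> sets M" "disjoint_family E" "(\<Union>i. E i) \<in> sets M"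
  show "(\<Sum>i. variation M \<mu> (E i)) = variation M \<mu> (\<Union>i. E i)"
  proof (rule antisym)
    have "(\<Sum>i<n. variation M \<mu> (E i)) \<le> variation M \<mu> (\<Union>i. E i)" for n
    proof (rule ennreal_le_epsilon)
      fix e :: real
      assume fin: "variation M \<mu> (\<Union>i. E i) < top" and e: "0 < e"
      define d where "d = e / (real n + 1)"
      have d: "d > 0" using e by (simp add: d_def)
      let ?P = "\<lambda>i A. range A \<subseteq> sets M \<and> disjoint_family (A :: nat \<Rightarrow> _) \<and> (\<Union>j. A j) = E i"
      let ?S = "\<lambda>A. \<Sum>j. ennreal (norm (\<mu> (A j)))"
      have triv: "?P i (\<lambda>j. if j = 0 then E i else {})" for i
        using E(1) by (auto simp: disjoint_family_on_def split: if_splits)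
      define Q where "Q = (\<lambda>i A. ?P i A \<and> (i < n \<longrightarrow> variation M \<mu> (E i) \<le> ?S A + ennreal d))"
      have comb: "(\<Sum>i. ?S (A i)) \<le> variation M \<mu> (\<Union>i. E i)" if A: "\<And>i. ?P i (A i)" for A
      proof -
        let ?B = "\<lambda>k. case prod_decode k of (i, j) \<Rightarrow> A i j"
        have "A i j \<in> sets M" for i j using A[of i] by blast
        then have 1: "range ?B \<subseteq> sets M" by (auto split: prod.split)
        have sub: "A i j \<subseteq> E i" for i j using A[of i] by blast
        have 2: "disjoint_family ?B"
          unfolding disjoint_family_on_def
        proof (intro ballI impI)
          fix k l :: nat assume "k \<noteq> l"
          then have "prod_decode k \<noteq> prod_decode l"
            by (metis prod_decode_inverse)
          then obtain i j i' j' where ij: "prod_decode k = (i, j)" "prod_decode l = (i', j')"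
            "(i, j) \<noteq> (i', j')" by (metis surj_pair)
          show "?B k \<inter> ?B l = {}"
          proof (cases "i = i'")
            case True
            then show ?thesis using ij A[of i] by (auto simp: disjoint_family_on_def)
          next
            case False
            then have "E i \<inter> E i' = {}" using E(2) by (auto simp: disjoint_family_on_def)
            then show ?thesis using ij sub[of i j] sub[of i' j'] by auto
          qed
        qed
        have 3: "(\<Union>k. ?B k) = (\<Union>i. E i)"
        proof (intro set_eqI iffI)
          fix x assume "x \<in> (\<Union>i. E i)"
          then obtain i where "x \<in> E i" by blast
          then obtain j where "x \<in> A i j" using A[of i] by blast
          then have "x \<in> ?B (prod_encode (i, j))" by simp
          then show "x \<in> (\<Union>k. ?B k)" by (rule UN_I[OF UNIV_I])
        next
          fix x assume "x \<in> (\<Union>k. ?B k)"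
          then obtain k where "x \<in> ?B k" by (rule UN_E)
          then show "x \<in> (\<Union>i. E i)" using sub by (auto split: prod.splits)
        qed
        have "(\<Sum>i. ?S (A i)) = (\<Sum>k. case prod_decode k of (i, j) \<Rightarrow> ennreal (norm (\<mu> (A i j))))"
          by (rule suminf_ennreal_2dimen[symmetric]) simp
        also have "\<dots> = (\<Sum>k. ennreal (norm (\<mu> (?B k))))"
          by (intro suminf_cong) (simp split: prod.split)
        also have "\<dots> \<le> variation M \<mu> (\<Union>i. E i)" by (rule variation_ge[OF 1 2 3])
        finally show ?thesis .
      qed
      have le: "variation M \<mu> (E i) \<le> variation M \<mu> (\<Union>i. E i)" for i
      proof -
        have "?S A \<le> variation M \<mu> (\<Union>i. E i)" if A: "?P i A" for A
        proof -
          let ?A = "\<lambda>k. if k = i then A else (\<lambda>j. if j = 0 then E k else {})"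
          have "(\<Sum>k\<in>{i}. ?S (?A k)) \<le> (\<Sum>k. ?S (?A k))" by (rule sum_le_suminf) auto
          also have "\<dots> \<le> variation M \<mu> (\<Union>i. E i)"
          proof (rule comb)
            fix k
            show "?P k (?A k)"
            proof (cases "k = i")
              case True
              then show ?thesis using A by (simp only: refl if_True)
            next
              case False
              then show ?thesis using triv[of k] by (simp only: if_False)
            qed
          qed
          finally show ?thesis by simp
        qed
        then show ?thesis unfolding variation_def[of M \<mu> "E i"] by (intro SUP_least) auto
      qed
      have "\<exists>A. Q i A" for i
      proof (cases "variation M \<mu> (E i) = 0")
        case True
        then have "Q i (\<lambda>j. if j = 0 then E i else {})"
          unfolding Q_def using triv[of i] by (metis zero_le)
        then show ?thesis by (rule exI[of "Q i"])
      next
        case False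
        have "variation M \<mu> (E i) < top" using le[of i] fin by (rule le_less_trans)
        then have "variation M \<mu> (E i) - ennreal d < variation M \<mu> (E i)"
          using False d by (intro ennreal_between) (auto simp: zero_less_iff_neq_zero)
        then obtain A where "?P i A" "variation M \<mu> (E i) - ennreal d < ?S A"
          unfolding variation_def less_SUP_iff by auto
        moreover from this(2) have "variation M \<mu> (E i) \<le> ?S A + ennreal d"
          by (metis add.commute ennreal_minus_le_iff less_imp_le)
        ultimately have "Q i A" unfolding Q_def by (simp only: HOL.simp_thms)
        then show ?thesis by (rule exI[of "Q i"])
      qed
      then obtain A where A: "\<And>i. Q i (A i)" by metis
      have "(\<Sum>i<n. variation M \<mu> (E i)) \<le> (\<Sum>i<n. ?S (A i) + ennreal d)"
        using A unfolding Q_def by (intro sum_mono) auto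
      also have "\<dots> = (\<Sum>i<n. ?S (A i)) + ennreal (real n * d)"
        using d by (simp add: sum.distrib ennreal_mult ennreal_of_nat_eq_real_of_nat)
      also have "\<dots> \<le> variation M \<mu> (\<Union>i. E i) + ennreal e"
      proof (intro add_mono ennreal_leI)
        show "(\<Sum>i<n. ?S (A i)) \<le> variation M \<mu> (\<Union>i. E i)"
          using A unfolding Q_def by (intro order_trans[OF sum_le_suminf comb]) auto
        show "real n * d \<le> e" using e by (simp add: d_def field_simps)
      qed
      finally show "(\<Sum>i<n. variation M \<mu> (E i)) \<le> variation M \<mu> (\<Union>i. E i) + ennreal e" .
    qed
    then show "(\<Sum>i. variation M \<mu> (E i)) \<le> variation M \<mu> (\<Union>i. E i)"
      by (intro suminf_le_const) auto
  next
    show "variation M \<mu> (\<Union>i. E i) \<le> (\<Sum>i. variation M \<mu> (E i))"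
      unfolding variation_def[of M \<mu> "\<Union>i. E i"]
    proof (rule SUP_least)
      fix A :: "nat \<Rightarrow> 'a set"
      assume "A \<in> {A. range A \<subseteq> sets M \<and> disjoint_family A \<and> (\<Union>i. A i) = (\<Union>i. E i)}"
      then have A: "range A \<subseteq> sets M" "disjoint_family A" "(\<Union>i. A i) = (\<Union>i. E i)" by auto
      have "(\<Sum>j. ennreal (norm (\<mu> (A j)))) \<le> (\<Sum>j. \<Sum>i. ennreal (norm (\<mu> (A j \<inter> E i))))"
      proof (intro suminf_le)
        fix j
        have "disjoint_family (\<lambda>i. A j \<inter> E i)"
          using E(2) by (rule disjoint_family_on_bisimulation) auto
        then have "(\<lambda>i. \<mu> (A j \<inter> E i)) sums \<mu> (\<Union>i. A j \<inter> E i)"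
          by (intro \<mu>[unfolded complex_measure_def, rule_format]) (use A(1) E(1) in auto)
        also have "(\<Union>i. A j \<inter> E i) = A j" using A(3) by blast
        finally show "ennreal (norm (\<mu> (A j))) \<le> (\<Sum>i. ennreal (norm (\<mu> (A j \<inter> E i))))"
          by (rule ennreal_norm_sums_le)
      qed auto
      also have "\<dots> = (\<Sum>i. \<Sum>j. ennreal (norm (\<mu> (A j \<inter> E i))))"
        by (rule ennreal_suminf_swap)
      also have "\<dots> \<le> (\<Sum>i. variation M \<mu> (E i))"
      proof (intro suminf_le variation_ge)
        fix i
        show "range (\<lambda>j. A j \<inter> E i) \<subseteq> sets M" using A(1) E(1) by auto
        show "disjoint_family (\<lambda>j. A j \<inter> E i)" 
          using A(2) by (rule disjoint_family_on_bisimulation) auto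
        show "(\<Union>j. A j \<inter> E i) = E i" using A(3) by blast
      qed auto
      finally show "(\<Sum>j. ennreal (norm (\<mu> (A j)))) \<le> (\<Sum>i. variation M \<mu> (E i))" .
    qed
  qed
qed

lemma variation_empty:
  assumes "complex_measure M \<mu>"
  shows "variation M \<mu> {} = 0"
proof -
  have "(\<Sum>i. ennreal (norm (\<mu> (A i)))) = 0" if "(\<Union>i. A i) = {}" for A :: "nat \<Rightarrow> 'a set"
    using that complex_measure_empty[OF assms] by auto
  then show ?thesis
    unfolding variation_def by (intro antisym SUP_least) auto
qed

lemma sets_total_variation [simp, measurable_cong]: "sets (total_variation M \<mu>) = sets M"
  by (simp add: total_variation_def)

lemma space_total_variation [simp]: "space (total_variation M \<mu>) = space M"
  by (simp add: total_variation_def)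

theorem emeasure_total_variation:
  assumes "complex_measure M \<mu>" "E \<in> sets M"
  shows "emeasure (total_variation M \<mu>) E = variation M \<mu> E"
  unfolding total_variation_def
  using assms variation_empty countably_additive_variation
  by (intro emeasure_measure_of_sigma) (auto simp: positive_def sets.sigma_algebra_axioms)

end

theory Submission
  imports Defs
begin

text \<open>The new representing measure is the mixture \<open>\<nu>(B) = \<integral> K(z, B) d\<rho>(z)\<close> of the measures
  \<open>K(z, \<cdot>)\<close> that represent the single neurons \<open>z = (w, b)\<close>. The theorem then comes down to two facts
  about mixtures: \<open>\<integral> g d|\<nu>| \<le> \<integral>\<integral> g d|K(z, \<cdot>)| d|\<rho>|(z)\<close> for \<open>g \<ge> 0\<close> (lemma \<open>nn_integral_mixture_le\<close>), and
  the Fubini formula \<open>\<integral> g d\<nu> = \<integral>\<integral> g dK(z, \<cdot>) d\<rho>(z)\<close> (theorem \<open>complex_integral_mixture\<close>). With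
  \<open>g(w, b) = \<phi>\<^sub>1(\<parallel>w\<parallel>\<^sub>1 + |b|)\<close> the first one gives the bound on the norm, and with
  \<open>g(w, b) = \<sigma>\<^sub>1(w \<cdot> x + b)\<close> the second one gives the representation of \<open>f\<close>.

  The hypotheses on the kernel hold only on the support of \<open>\<rho>\<close>, whose complement is \<open>|\<rho>|\<close>-null because
  the topology has a countable basis. For the mixture to be defined, the mass of \<open>K(z, \<cdot>)\<close> has to be
  integrable in \<open>z\<close>. This comes from \<open>\<phi>\<^sub>1 \<ge> \<phi>\<^sub>1(0) > 0\<close>, which bounds the mass \<open>|K(z, \<cdot>)|(\<real>\<^sup>d\<^sup>+\<^sup>1)\<close>
  by \<open>M \<phi>\<^sub>2(\<parallel>w\<parallel>\<^sub>1 + |b|) / \<phi>\<^sub>1(0)\<close>, a \<open>|\<rho>|\<close>-integrable function of \<open>z = (w, b)\<close>.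

  Integrals against complex measures are integrals against the polar density, so that everything
  rests on the existence of that density. It follows from the Radon-Nikodym theorem, applied to the
  real and imaginary parts, and from comparing \<open>\<mu>(E)\<close> with \<open>|\<mu>|(E)\<close> to see that the density is
  unimodular.

  For a sequence of representing measures as in the second claim, the bound passes to the limit. The
  continuity of the embedding is this bound applied to differences: these belong to the Barron space
  as soon as their norm is finite.\<close>

section \<open>Polar decomposition\<close>

lemma norm_le_total_variation:
  assumes "complex_measure M \<mu>" "E \<in> sets M"
  shows "ennreal (norm (\<mu> E)) \<le> emeasure (total_variation M \<mu>) E"
proof -
  let ?A = "\<lambda>i::nat. if i = 0 then E else {}"
  have "ennreal (norm (\<mu> E)) = (\<Sum>i\<in>{0}. ennreal (norm (\<mu> (?A i))))" by simp
  also have "\<dots> \<le> (\<Sum>i. ennreal (norm (\<mu> (?A i))))" by (rule sum_le_suminf) auto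
  also have "\<dots> \<le> variation M \<mu> E"
    by (rule variation_ge) (use assms in \<open>auto simp: disjoint_family_on_def split: if_splits\<close>)
  finally show ?thesis using emeasure_total_variation[OF assms] by simp
qed

text \<open>A real set function dominated by \<open>M\<close> becomes nonnegative by adding \<open>M\<close>. The Radon-Nikodym theorem
  gives a density of the sum, and subtracting \<open>1\<close> gives one of \<open>\<nu>\<close>.\<close>

lemma (in finite_measure) real_measure_density:
  fixes \<nu> :: "'a set \<Rightarrow> real"
  assumes add: "\<And>A :: nat \<Rightarrow> 'a set. range A \<subseteq> sets M \<Longrightarrow> disjoint_family A \<Longrightarrow>
      (\<lambda>i. \<nu> (A i)) sums \<nu> (\<Union>i. A i)"
    and bound: "\<And>E. E \<in> sets M \<Longrightarrow> \<bar>\<nu> E\<bar> \<le> measure M E"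
  obtains p where "integrable M p" "\<And>E. E \<in> sets M \<Longrightarrow> \<nu> E = (LINT x:E|M. p x)"
proof -
  define P where "P = measure_of (space M) (sets M) (\<lambda>E. ennreal (\<nu> E + measure M E))"
  have nn: "0 \<le> \<nu> E + measure M E" if "E \<in> sets M" for E
    using bound[OF that] by linarith
  have sP[simp]: "sets P = sets M" "space P = space M" by (simp_all add: P_def)
  have eP: "emeasure P E = ennreal (\<nu> E + measure M E)" if "E \<in> sets M" for E
    unfolding P_def
  proof (rule emeasure_measure_of_sigma)
    show "sigma_algebra (space M) (sets M)" by (rule sets.sigma_algebra_axioms)
    show "positive (sets M) (\<lambda>E. ennreal (\<nu> E + measure M E))"
      using bound[of "{}"] by (simp add: positive_def)
    show "countably_additive (sets M) (\<lambda>E. ennreal (\<nu> E + measure M E))"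
    proof (rule countably_additiveI)
      fix A :: "nat \<Rightarrow> 'a set"
      assume A: "range A \<subseteq> sets M" "disjoint_family A" "(\<Union>i. A i) \<in> sets M"
      show "(\<Sum>i. ennreal (\<nu> (A i) + measure M (A i)))
          = ennreal (\<nu> (\<Union>i. A i) + measure M (\<Union>i. A i))"
        by (rule suminf_ennreal_eq)
          (use A in \<open>auto intro!: nn sums_add add finite_measure_UNION\<close>)
    qed
  qed (rule that)
  have fP: "finite_measure P"
    by (rule finite_measureI) (simp add: eP)
  have ac: "absolutely_continuous M P"
    unfolding absolutely_continuous_def
  proof
    fix E assume "E \<in> null_sets M"
    then have E: "E \<in> sets M" "measure M E = 0" by (auto simp: measure_eq_0_null_sets)
    then show "E \<in> null_sets P" using bound[of E] by (auto simp: null_sets_def eP)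
  qed
  obtain D where D: "D \<in> borel_measurable M" "AE x in M. RN_deriv M P x = ennreal (D x)"
    "\<And>x. 0 \<le> D x"
    using real_RN_deriv[OF fP ac] by auto
  have DE: "integrable M (\<lambda>x. indicator E x * D x) \<and>
      (\<integral>x. indicator E x * D x \<partial>M) = \<nu> E + measure M E" if E: "E \<in> sets M" for E
  proof -
    have "(\<integral>\<^sup>+x. ennreal (indicator E x * D x) \<partial>M) = (\<integral>\<^sup>+x. RN_deriv M P x * indicator E x \<partial>M)"
      by (rule nn_integral_cong_AE) (use D(2) in \<open>auto split: split_indicator\<close>)
    also have "\<dots> = emeasure (density M (RN_deriv M P)) E"
      using E by (simp add: emeasure_density)
    also have "\<dots> = ennreal (\<nu> E + measure M E)"
      using density_RN_deriv[OF ac] eP[OF E] by simp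
    finally show ?thesis
      using D nn[OF E] E by (subst (asm) nn_integral_eq_integrable) auto
  qed
  have intD: "integrable M D"
    using DE[of "space M"] by (simp cong: Bochner_Integration.integrable_cong)
  show thesis
  proof
    show "integrable M (\<lambda>x. D x - 1)" using intD by simp
    fix E assume E: "E \<in> sets M"
    have "(LINT x:E|M. D x - 1) = (\<integral>x. indicator E x * D x - indicator E x \<partial>M)"
      unfolding set_lebesgue_integral_def
      by (intro Bochner_Integration.integral_cong) (auto split: split_indicator)
    also have "\<dots> = \<nu> E + measure M E - measure M E"
      using E DE[OF E] by (subst Bochner_Integration.integral_diff) (auto simp: less_top[symmetric])
    finally show "\<nu> E = (LINT x:E|M. D x - 1)" by simp
  qed
qed

lemma AE_nonpos_of_set_integral_nonpos:
  fixes g :: "'a \<Rightarrow> real"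
  assumes g: "integrable M g" and le: "\<And>E. E \<in> sets M \<Longrightarrow> (LINT x:E|M. g x) \<le> 0"
  shows "AE x in M. g x \<le> 0"
proof -
  have [measurable]: "g \<in> borel_measurable M" using g by auto
  let ?E = "{x \<in> space M. g x > 0}"
  let ?g = "\<lambda>x. indicator ?E x * g x"
  have i: "integrable M ?g"
    by (rule Bochner_Integration.integrable_bound[OF g]) (auto split: split_indicator)
  have nn: "AE x in M. 0 \<le> ?g x" by (auto split: split_indicator)
  have "integral\<^sup>L M ?g \<le> 0"
    using le[of ?E] by (simp add: set_lebesgue_integral_def)
  moreover have "0 \<le> integral\<^sup>L M ?g" by (rule integral_nonneg_AE[OF nn])
  ultimately have "AE x in M. ?g x = 0"
    using integral_nonneg_eq_0_iff_AE[OF i nn] by simp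
  then show ?thesis by (rule AE_mp) (auto split: split_indicator)
qed

text \<open>Finiteness of the variation is part of the locale: below, it always comes from the finiteness of a
  weighted variation or from a mixture bound.\<close>

locale finite_complex_measure =
  fixes M :: "'a measure" and \<mu> :: "'a set \<Rightarrow> complex"
  assumes complex_measure: "complex_measure M \<mu>"
    and finite_variation: "emeasure (total_variation M \<mu>) (space M) < \<infinity>"

sublocale finite_complex_measure \<subseteq> tv: finite_measure "total_variation M \<mu>"
  by (rule finite_measureI) (use finite_variation in \<open>auto simp: less_top\<close>)

context finite_complex_measure
begin

lemma norm_le_measure:
  assumes "E \<in> sets M"
  shows "norm (\<mu> E) \<le> measure (total_variation M \<mu>) E"
  using norm_le_total_variation[OF complex_measure assms]
  by (simp add: tv.emeasure_eq_measure)

text \<open>Radon-Nikodym gives some complex density \<open>h\<close> of \<open>\<mu>\<close> with respect to \<open>|\<mu>|\<close>. The total variation is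
  at most \<open>|h| d|\<mu>|\<close>, so \<open>|h| \<ge> 1\<close> a.e. Conversely \<open>Re (c \<mu>(E)) \<le> |c| |\<mu>|(E)\<close> for every
  \<open>c\<close> gives \<open>Re (c h) \<le> |c|\<close> a.e.; letting \<open>c\<close> run through a countable dense set makes the null set
  independent of \<open>c\<close>, and \<open>c = cnj h\<close> yields \<open>|h| \<le> 1\<close>.\<close>

lemma ex_polar_density:
  "\<exists>h. h \<in> borel_measurable M \<and> (\<forall>x\<in>space M. norm (h x) = 1) \<and>
     (\<forall>E\<in>sets M. \<mu> E = (LINT x:E|total_variation M \<mu>. h x))"
proof -
  let ?T = "total_variation M \<mu>"
  have sums: "(\<lambda>i. \<mu> (A i)) sums \<mu> (\<Union>i. A i)"
    if "range A \<subseteq> sets M" "disjoint_family A" for A :: "nat \<Rightarrow> 'a set"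
    using complex_measure that unfolding complex_measure_def by blast
  obtain p where p: "integrable ?T p" "\<And>E. E \<in> sets M \<Longrightarrow> Re (\<mu> E) = (LINT x:E|?T. p x)"
  proof (rule tv.real_measure_density[of "\<lambda>E. Re (\<mu> E)"])
    show "\<bar>Re (\<mu> E)\<bar> \<le> measure ?T E" if "E \<in> sets ?T" for E
      using norm_le_measure[of E] abs_Re_le_cmod[of "\<mu> E"] that by simp
  qed (auto intro!: sums_Re sums)
  obtain q where q: "integrable ?T q" "\<And>E. E \<in> sets M \<Longrightarrow> Im (\<mu> E) = (LINT x:E|?T. q x)"
  proof (rule tv.real_measure_density[of "\<lambda>E. Im (\<mu> E)"])
    show "\<bar>Im (\<mu> E)\<bar> \<le> measure ?T E" if "E \<in> sets ?T" for E
      using norm_le_measure[of E] abs_Im_le_cmod[of "\<mu> E"] that by simp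
  qed (auto intro!: sums_Im sums)
  define h where "h x = Complex (p x) (q x)" for x
  have h_alt: "h = (\<lambda>x. complex_of_real (p x) + \<i> * complex_of_real (q x))"
    by (auto simp: h_def fun_eq_iff complex_eq_iff)
  have ih: "integrable ?T h"
    unfolding h_alt using p(1) q(1) by auto
  have [measurable]: "h \<in> borel_measurable M"
    using borel_measurable_integrable[OF ih] by simp
  have ihE: "set_integrable ?T E h" if "E \<in> sets M" for E
    using ih that unfolding set_integrable_def by (intro integrable_mult_indicator) auto
  have \<mu>h: "\<mu> E = (LINT x:E|?T. h x)" if E: "E \<in> sets M" for E
  proof (rule complex_eqI)
    have "Re (LINT x:E|?T. h x) = (LINT x:E|?T. Re (h x))"
      using ihE[OF E] unfolding set_integrable_def set_lebesgue_integral_def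
      by (subst integral_Re[symmetric]) auto
    then show "Re (\<mu> E) = Re (LINT x:E|?T. h x)" using p(2)[OF E] by (simp add: h_def)
    have "Im (LINT x:E|?T. h x) = (LINT x:E|?T. Im (h x))"
      using ihE[OF E] unfolding set_integrable_def set_lebesgue_integral_def
      by (subst integral_Im[symmetric]) auto
    then show "Im (\<mu> E) = Im (LINT x:E|?T. h x)" using q(2)[OF E] by (simp add: h_def)
  qed
  have cst: "(LINT x:E|?T. c) = c * measure ?T E" if "E \<in> sets M" for E and c :: real
    using that by (simp add: set_lebesgue_integral_def)
  \<comment> \<open>The variation of \<open>h d|\<mu>|\<close> is at most \<open>|h| d|\<mu>|\<close>.\<close>
  have "AE x in ?T. 1 - norm (h x) \<le> 0"
  proof (rule AE_nonpos_of_set_integral_nonpos)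
    show "integrable ?T (\<lambda>x. 1 - norm (h x))" using ih by auto
    fix E assume "E \<in> sets ?T"
    then have E: "E \<in> sets M" by simp
    have nE: "set_integrable ?T A (\<lambda>x. norm (h x))" if "A \<in> sets M" for A
      using integrable_mult_indicator[OF _ integrable_norm[OF ih], of A] that
      by (simp add: set_integrable_def)
    have eN: "emeasure (density ?T (\<lambda>x. ennreal (norm (h x)))) A = ennreal (LINT x:A|?T. norm (h x))"
      if A: "A \<in> sets M" for A
    proof -
      have "emeasure (density ?T (\<lambda>x. ennreal (norm (h x)))) A
          = (\<integral>\<^sup>+x. ennreal (indicator A x *\<^sub>R norm (h x)) \<partial>?T)"
        using A by (auto simp: emeasure_density intro!: nn_integral_cong split: split_indicator)
      also have "\<dots> = ennreal (LINT x:A|?T. norm (h x))"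
        unfolding set_lebesgue_integral_def
        by (rule nn_integral_eq_integral) (use nE[OF A] in \<open>auto simp: set_integrable_def\<close>)
      finally show ?thesis .
    qed
    have "variation M \<mu> E \<le> ennreal (LINT x:E|?T. norm (h x))"
      unfolding variation_def
    proof (rule SUP_least)
      fix A :: "nat \<Rightarrow> 'a set"
      assume "A \<in> {A. range A \<subseteq> sets M \<and> disjoint_family A \<and> (\<Union>i. A i) = E}"
      then have A: "\<And>i. A i \<in> sets M" "disjoint_family A" "(\<Union>i. A i) = E" by auto
      have "(\<Sum>i. ennreal (norm (\<mu> (A i)))) \<le> (\<Sum>i. ennreal (LINT x:A i|?T. norm (h x)))"
      proof (intro suminf_le ennreal_leI)
        fix i
        have "norm (\<mu> (A i)) \<le> (\<integral>x. norm (indicator (A i) x *\<^sub>R h x) \<partial>?T)"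
          unfolding \<mu>h[OF A(1)] set_lebesgue_integral_def by (rule integral_norm_bound)
        then show "norm (\<mu> (A i)) \<le> (LINT x:A i|?T. norm (h x))"
          by (simp add: set_lebesgue_integral_def)
      qed auto
      also have "\<dots> = ennreal (LINT x:E|?T. norm (h x))"
        using suminf_emeasure[of A "density ?T (\<lambda>x. ennreal (norm (h x)))"] A
        by (simp add: eN E image_subset_iff)
      finally show "(\<Sum>i. ennreal (norm (\<mu> (A i)))) \<le> ennreal (LINT x:E|?T. norm (h x))" .
    qed
    then have "measure ?T E \<le> (LINT x:E|?T. norm (h x))"
      unfolding emeasure_total_variation[OF complex_measure E, symmetric] tv.emeasure_eq_measure
      by (subst (asm) ennreal_le_iff) (auto simp: set_lebesgue_integral_def)
    moreover have "(LINT x:E|?T. 1 - norm (h x)) = (LINT x:E|?T. 1) - (LINT x:E|?T. norm (h x))"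
      by (rule set_integral_diff) (use E nE in \<open>auto simp: set_integrable_def less_top[symmetric]\<close>)
    ultimately show "(LINT x:E|?T. 1 - norm (h x)) \<le> 0" using cst[OF E, of 1] by simp
  qed
  moreover
  obtain Q :: "complex set" where Q: "countable Q" "\<And>X. open X \<Longrightarrow> X \<noteq> {} \<Longrightarrow> \<exists>d\<in>Q. d \<in> X"
    by (rule countable_dense_setE) blast
  have "AE x in ?T. \<forall>c\<in>Q. Re (c * h x) - norm c \<le> 0"
    unfolding AE_ball_countable[OF Q(1)]
  proof
    fix c assume "c \<in> Q"
    have ic: "integrable ?T (\<lambda>x. Re (c * h x))" using ih by (intro integrable_Re) auto
    show "AE x in ?T. Re (c * h x) - norm c \<le> 0"
    proof (rule AE_nonpos_of_set_integral_nonpos)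
      show "integrable ?T (\<lambda>x. Re (c * h x) - norm c)" using ic by auto
      fix E assume "E \<in> sets ?T"
      then have E: "E \<in> sets M" by simp
      have "(LINT x:E|?T. Re (c * h x)) = Re (LINT x:E|?T. c * h x)"
        using set_integrable_mult_right[of c ?T E h] ihE[OF E]
        unfolding set_integrable_def set_lebesgue_integral_def
        by (subst integral_Re[symmetric]) auto
      also have "\<dots> = Re (c * \<mu> E)" by (simp add: \<mu>h[OF E])
      also have "\<dots> \<le> norm c * norm (\<mu> E)" by (metis complex_Re_le_cmod norm_mult)
      also have "\<dots> \<le> norm c * measure ?T E" by (intro mult_left_mono norm_le_measure E) auto
      finally have le: "(LINT x:E|?T. Re (c * h x)) \<le> norm c * measure ?T E" .
      have "(LINT x:E|?T. Re (c * h x) - norm c)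
          = (LINT x:E|?T. Re (c * h x)) - (LINT x:E|?T. norm c)"
        by (rule set_integral_diff)
          (use E integrable_mult_indicator[OF _ ic, of E] in
            \<open>auto simp: set_integrable_def less_top[symmetric]\<close>)
      then show "(LINT x:E|?T. Re (c * h x) - norm c) \<le> 0" using le cst[OF E] by simp
    qed
  qed
  ultimately have ae1: "AE x in ?T. norm (h x) = 1"
  proof eventually_elim
    case (elim x)
    have nonpos: "Re (c * h x) - norm c \<le> 0" for c
    proof (rule ccontr)
      assume "\<not> ?thesis"
      then have "c \<in> {c. Re (c * h x) - norm c > 0}" by simp
      moreover have "open {c. Re (c * h x) - norm c > 0}"
        by (intro open_Collect_less continuous_intros)
      ultimately obtain d where "d \<in> Q" "d \<in> {c. Re (c * h x) - norm c > 0}"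
        using Q(2) by blast
      then show False using elim(2) by auto
    qed
    have "cnj (h x) * h x = complex_of_real (norm (h x) * norm (h x))"
      using complex_norm_square[of "h x"] by (simp add: power2_eq_square mult.commute)
    then have "norm (h x) * norm (h x) - norm (h x) \<le> 0"
      using nonpos[of "cnj (h x)"] by (simp only: complex_mod_cnj Re_complex_of_real)
    then have "norm (h x) * (norm (h x) - 1) \<le> 0" by (simp add: algebra_simps)
    then have "norm (h x) \<le> 1" using elim(1) by (auto simp: mult_le_0_iff)
    then show ?case using elim(1) by simp
  qed
  \<comment> \<open>The polar density is unimodular everywhere, so \<open>h\<close> is changed on a null set.\<close>
  define k where "k x = (if norm (h x) = 1 then h x else 1)" for x
  have [measurable]: "k \<in> borel_measurable M" unfolding k_def[abs_def] by measurable
  have "\<mu> E = (LINT x:E|?T. k x)" if "E \<in> sets M" for E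
    unfolding \<mu>h[OF that] set_lebesgue_integral_def
    by (rule integral_cong_AE) (use ae1 that in \<open>auto simp: k_def\<close>)
  moreover have "norm (k x) = 1" for x by (simp add: k_def)
  ultimately show ?thesis by (intro exI[of _ k]) auto
qed

lemma polar_density_measurable [measurable]: "polar_density M \<mu> \<in> borel_measurable M"
  and norm_polar_density: "x \<in> space M \<Longrightarrow> norm (polar_density M \<mu> x) = 1"
  and eq_set_integral_polar_density:
    "E \<in> sets M \<Longrightarrow> \<mu> E = (LINT x:E|total_variation M \<mu>. polar_density M \<mu> x)"
  using someI_ex[OF ex_polar_density] unfolding polar_density_def[symmetric] by auto

end

section \<open>Integration against a complex measure\<close>

context finite_complex_measure
begin

lemma norm_mult_polar_density:
  "x \<in> space M \<Longrightarrow> norm (f x * polar_density M \<mu> x) = norm (f x)"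
  by (simp add: norm_mult norm_polar_density)

lemma integrable_mult_polar_density:
  assumes "integrable (total_variation M \<mu>) f"
  shows "integrable (total_variation M \<mu>) (\<lambda>x. f x * polar_density M \<mu> x)"
proof (rule Bochner_Integration.integrable_bound[OF assms])
  have "f \<in> borel_measurable M" using borel_measurable_integrable[OF assms] by simp
  then show "(\<lambda>x. f x * polar_density M \<mu> x) \<in> borel_measurable (total_variation M \<mu>)" by simp
qed (auto simp: norm_mult_polar_density)

text \<open>Together with linearity and dominated convergence, this determines the integral by the values
  of \<open>\<mu>\<close>; it is how the kernel \<open>K(z, B)\<close> enters the Fubini formula for mixtures.\<close>

lemma complex_integral_indicator:
  assumes "E \<in> sets M"
  shows "complex_integral M \<mu> (indicator E) = \<mu> E"
proof -
  have "complex_integral M \<mu> (indicator E)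
      = (\<integral>x. indicator E x *\<^sub>R polar_density M \<mu> x \<partial>total_variation M \<mu>)"
    unfolding complex_integral_def
    by (intro Bochner_Integration.integral_cong) (auto split: split_indicator)
  then show ?thesis
    using eq_set_integral_polar_density[OF assms] by (simp add: set_lebesgue_integral_def)
qed

lemma complex_integral_sum:
  assumes "\<And>i. i \<in> I \<Longrightarrow> integrable (total_variation M \<mu>) (f i)"
  shows "complex_integral M \<mu> (\<lambda>x. \<Sum>i\<in>I. f i x) = (\<Sum>i\<in>I. complex_integral M \<mu> (f i))"
  unfolding complex_integral_def sum_distrib_right
  by (intro Bochner_Integration.integral_sum integrable_mult_polar_density assms)

lemma complex_integral_cmult:
  "complex_integral M \<mu> (\<lambda>x. c * f x) = c * complex_integral M \<mu> f"
  unfolding complex_integral_def mult.assoc by simp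

lemma norm_complex_integral_le:
  "ennreal (norm (complex_integral M \<mu> f)) \<le> (\<integral>\<^sup>+x. norm (f x) \<partial>total_variation M \<mu>)"
proof -
  let ?g = "\<lambda>x. f x * polar_density M \<mu> x"
  have "ennreal (norm (complex_integral M \<mu> f)) \<le> (\<integral>\<^sup>+x. norm (?g x) \<partial>total_variation M \<mu>)"
    unfolding complex_integral_def
    by (cases "integrable (total_variation M \<mu>) ?g")
      (simp_all add: integral_norm_bound_ennreal not_integrable_integral_eq)
  also have "\<dots> = (\<integral>\<^sup>+x. norm (f x) \<partial>total_variation M \<mu>)"
    by (intro nn_integral_cong) (simp add: norm_mult_polar_density)
  finally show ?thesis .
qed

lemma complex_integral_dominated_convergence:
  assumes [measurable]: "f \<in> borel_measurable M" "\<And>i. s i \<in> borel_measurable M"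
    and w: "integrable (total_variation M \<mu>) w"
    and lim: "AE x in total_variation M \<mu>. (\<lambda>i. s i x) \<longlonglongrightarrow> f x"
    and bound: "\<And>i. AE x in total_variation M \<mu>. norm (s i x) \<le> w x"
  shows "(\<lambda>i. complex_integral M \<mu> (s i)) \<longlonglongrightarrow> complex_integral M \<mu> f"
  unfolding complex_integral_def
proof (rule integral_dominated_convergence[OF _ _ w])
  show "AE x in total_variation M \<mu>. (\<lambda>i. s i x * polar_density M \<mu> x)
      \<longlonglongrightarrow> f x * polar_density M \<mu> x"
    using lim by eventually_elim (intro tendsto_intros)
  show "AE x in total_variation M \<mu>. norm (s i x * polar_density M \<mu> x) \<le> w x" for i
    using bound[of i] by (rule AE_mp) (auto simp: norm_mult_polar_density)
qed auto

lemma complex_integral_simple_function: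
  assumes s: "simple_function M s"
  shows "complex_integral M \<mu> s = (\<Sum>y\<in>s ` space M. y * \<mu> (s -` {y} \<inter> space M))"
proof -
  let ?E = "\<lambda>y. s -` {y} \<inter> space M"
  have E: "?E y \<in> sets M" for y by (rule simple_functionD(2)[OF s])
  have "complex_integral M \<mu> s = complex_integral M \<mu> (\<lambda>x. \<Sum>y\<in>s ` space M. y * indicator (?E y) x)"
    unfolding complex_integral_def
  proof (rule Bochner_Integration.integral_cong[OF refl])
    fix x assume "x \<in> space (total_variation M \<mu>)"
    then have "s x = (\<Sum>y\<in>s ` space M. indicator (?E y) x *\<^sub>R y)"
      by (intro simple_function_indicator_representation_banach[OF s]) (simp only: space_total_variation)
    also have "\<dots> = (\<Sum>y\<in>s ` space M. y * indicator (?E y) x)"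
      by (intro sum.cong refl) (simp only: scaleR_conv_of_real of_real_indicator mult.commute)
    finally show "s x * polar_density M \<mu> x
        = (\<Sum>y\<in>s ` space M. y * indicator (?E y) x) * polar_density M \<mu> x" by (simp only:)
  qed
  also have "\<dots> = (\<Sum>y\<in>s ` space M. complex_integral M \<mu> (\<lambda>x. y * indicator (?E y) x))"
    by (intro complex_integral_sum integrable_mult_right tv.integrable_const_bound[where B = 1])
      (auto simp: E intro!: borel_measurable_indicator split: split_indicator)
  also have "\<dots> = (\<Sum>y\<in>s ` space M. y * \<mu> (?E y))"
    by (simp only: complex_integral_cmult complex_integral_indicator[OF E])
  finally show ?thesis .
qed

end

section \<open>Mixtures of a kernel\<close>

lemma integrable_enn2real:
  assumes [measurable]: "f \<in> borel_measurable M" and "(\<integral>\<^sup>+x. f x \<partial>M) < \<infinity>"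
  shows "integrable M (\<lambda>x. enn2real (f x))"
proof (rule integrableI_nonneg)
  have "(\<integral>\<^sup>+x. ennreal (enn2real (f x)) \<partial>M) \<le> (\<integral>\<^sup>+x. f x \<partial>M)"
    by (intro nn_integral_mono) (metis ennreal_enn2real_if order_refl zero_le)
  then show "(\<integral>\<^sup>+x. ennreal (enn2real (f x)) \<partial>M) < \<infinity>" using assms(2) by (rule le_less_trans)
qed auto

lemma le_enn2real_of_ennreal_le:
  "ennreal x \<le> e \<Longrightarrow> e < \<infinity> \<Longrightarrow> x \<le> enn2real e"
  by (cases e) (auto simp: ennreal_le_iff2)

text \<open>The finite mass in \<open>finite_mass\<close> makes \<open>\<integral> K(z, B) d\<rho>(z)\<close> an absolutely convergent integral and
  ensures that \<open>K(z, \<cdot>)\<close> has finite variation for \<open>|\<rho>|\<close>-almost every \<open>z\<close>.\<close>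

locale kernel_mixture = finite_complex_measure X \<rho> for X :: "'a measure" and \<rho> +
  fixes Y :: "'b measure" and K :: "'a \<Rightarrow> 'b set \<Rightarrow> complex"
  assumes kernel: "complex_kernel X Y K"
    and finite_mass:
      "(\<integral>\<^sup>+z. emeasure (total_variation Y (K z)) (space Y) \<partial>total_variation X \<rho>) < \<infinity>"
begin

definition mixture :: "'b set \<Rightarrow> complex" where
  "mixture B = complex_integral X \<rho> (\<lambda>z. K z B)"

lemma complex_measure_kernel: "z \<in> space X \<Longrightarrow> complex_measure Y (K z)"
  and kernel_measurable [measurable]: "B \<in> sets Y \<Longrightarrow> (\<lambda>z. K z B) \<in> borel_measurable X"
  and kernel_variation_measurable [measurable]:
    "B \<in> sets Y \<Longrightarrow> (\<lambda>z. emeasure (total_variation Y (K z)) B) \<in> borel_measurable X"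
  using kernel unfolding complex_kernel_def by auto

lemma AE_finite_complex_measure_kernel:
  "AE z in total_variation X \<rho>. finite_complex_measure Y (K z)"
proof -
  have "AE z in total_variation X \<rho>. emeasure (total_variation Y (K z)) (space Y) \<noteq> \<infinity>"
    by (rule nn_integral_PInf_AE) (use finite_mass in auto)
  then show ?thesis
    by (rule AE_mp)
      (auto intro!: AE_I2 complex_measure_kernel simp: finite_complex_measure_def less_top)
qed

lemma integrable_kernel_mass:
  "integrable (total_variation X \<rho>) (\<lambda>z. enn2real (emeasure (total_variation Y (K z)) (space Y)))"
  by (rule integrable_enn2real) (use finite_mass in auto)

lemma integrable_kernel:
  assumes [measurable]: "B \<in> sets Y"
  shows "integrable (total_variation X \<rho>) (\<lambda>z. K z B)"
proof (rule Bochner_Integration.integrable_bound[OF integrable_kernel_mass])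
  show "AE z in total_variation X \<rho>. norm (K z B)
      \<le> norm (enn2real (emeasure (total_variation Y (K z)) (space Y)))"
    using AE_finite_complex_measure_kernel
  proof eventually_elim
    case (elim z)
    interpret Kz: finite_complex_measure Y "K z" by (rule elim)
    have "ennreal (norm (K z B)) \<le> emeasure (total_variation Y (K z)) (space Y)"
      using norm_le_total_variation[OF Kz.complex_measure assms]
      by (rule order_trans) (auto intro!: emeasure_mono sets.sets_into_space)
    then show ?case by (simp add: le_enn2real_of_ennreal_le[OF _ Kz.finite_variation])
  qed
qed auto

text \<open>Countable additivity in \<open>B\<close> passes through the outer integral by dominated convergence: every
  partial sum of \<open>K(z, A\<^sub>i)\<close> is bounded by the total mass of \<open>|K(z, \<cdot>)|\<close>.\<close>

lemma complex_measure_mixture: "complex_measure Y mixture"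
  unfolding complex_measure_def
proof (intro allI impI)
  fix A :: "nat \<Rightarrow> 'b set"
  assume A: "range A \<subseteq> sets Y" "disjoint_family A"
  then have [measurable]: "A i \<in> sets Y" "(\<Union>i. A i) \<in> sets Y" for i by auto
  have "(\<lambda>n. complex_integral X \<rho> (\<lambda>z. \<Sum>i<n. K z (A i)))
      \<longlonglongrightarrow> complex_integral X \<rho> (\<lambda>z. K z (\<Union>i. A i))"
  proof (rule complex_integral_dominated_convergence[OF _ _ integrable_kernel_mass])
    show "AE z in total_variation X \<rho>. (\<lambda>n. \<Sum>i<n. K z (A i)) \<longlonglongrightarrow> K z (\<Union>i. A i)"
      using complex_measure_kernel A
      by (auto simp: complex_measure_def sums_def intro!: AE_I2)
    show "AE z in total_variation X \<rho>. norm (\<Sum>i<n. K z (A i))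
        \<le> enn2real (emeasure (total_variation Y (K z)) (space Y))" for n
      using AE_finite_complex_measure_kernel
    proof eventually_elim
      case (elim z)
      interpret Kz: finite_complex_measure Y "K z" by (rule elim)
      have "ennreal (norm (\<Sum>i<n. K z (A i))) \<le> ennreal (\<Sum>i<n. norm (K z (A i)))"
        by (intro ennreal_leI norm_sum)
      also have "\<dots> = (\<Sum>i<n. ennreal (norm (K z (A i))))" by simp
      also have "\<dots> \<le> (\<Sum>i. ennreal (norm (K z (A i))))" by (rule sum_le_suminf) auto
      also have "\<dots> \<le> variation Y (K z) (\<Union>i. A i)" by (rule variation_ge[OF A refl])
      also have "\<dots> = emeasure (total_variation Y (K z)) (\<Union>i. A i)"
        by (simp add: emeasure_total_variation Kz.complex_measure)
      also have "\<dots> \<le> emeasure (total_variation Y (K z)) (space Y)"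
        using A(1) by (intro emeasure_mono) (auto dest: sets.sets_into_space)
      finally show ?case by (rule le_enn2real_of_ennreal_le) (rule Kz.finite_variation)
    qed
  qed auto
  then show "(\<lambda>i. mixture (A i)) sums mixture (\<Union>i. A i)"
    unfolding sums_def mixture_def by (simp add: complex_integral_sum integrable_kernel)
qed

text \<open>For each partition of \<open>B\<close>, the triangle inequality under the integral gives
  \<open>\<Sum>\<^sub>i |\<nu>(A\<^sub>i)| \<le> \<integral> \<Sum>\<^sub>i |K(z, A\<^sub>i)| d|\<rho>|(z)\<close>, where the inner sum is at most \<open>|K(z, \<cdot>)|(B)\<close>.\<close>

lemma variation_mixture_le:
  assumes B: "B \<in> sets Y"
  shows "emeasure (total_variation Y mixture) B
    \<le> (\<integral>\<^sup>+z. emeasure (total_variation Y (K z)) B \<partial>total_variation X \<rho>)"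
  unfolding emeasure_total_variation[OF complex_measure_mixture B] variation_def
proof (rule SUP_least)
  fix A :: "nat \<Rightarrow> 'b set"
  assume "A \<in> {A. range A \<subseteq> sets Y \<and> disjoint_family A \<and> (\<Union>i. A i) = B}"
  then have A: "range A \<subseteq> sets Y" "disjoint_family A" "(\<Union>i. A i) = B" by auto
  have Ai[measurable]: "A i \<in> sets Y" for i using A by auto
  have "(\<Sum>i. ennreal (norm (mixture (A i))))
      \<le> (\<Sum>i. \<integral>\<^sup>+z. emeasure (total_variation Y (K z)) (A i) \<partial>total_variation X \<rho>)"
  proof (intro suminf_le)
    fix i
    have "ennreal (norm (mixture (A i))) \<le> (\<integral>\<^sup>+z. norm (K z (A i)) \<partial>total_variation X \<rho>)"
      unfolding mixture_def by (rule norm_complex_integral_le)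
    also have "\<dots> \<le> (\<integral>\<^sup>+z. emeasure (total_variation Y (K z)) (A i) \<partial>total_variation X \<rho>)"
      by (intro nn_integral_mono norm_le_total_variation complex_measure_kernel) auto
    finally show "ennreal (norm (mixture (A i)))
        \<le> (\<integral>\<^sup>+z. emeasure (total_variation Y (K z)) (A i) \<partial>total_variation X \<rho>)" .
  qed auto
  also have "\<dots> = (\<integral>\<^sup>+z. (\<Sum>i. emeasure (total_variation Y (K z)) (A i)) \<partial>total_variation X \<rho>)"
    by (rule nn_integral_suminf[symmetric]) simp
  also have "\<dots> = (\<integral>\<^sup>+z. emeasure (total_variation Y (K z)) B \<partial>total_variation X \<rho>)"
    using A by (intro nn_integral_cong) (simp add: suminf_emeasure)
  finally show "(\<Sum>i. ennreal (norm (mixture (A i))))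
      \<le> (\<integral>\<^sup>+z. emeasure (total_variation Y (K z)) B \<partial>total_variation X \<rho>)" .
qed

lemma finite_complex_measure_mixture: "finite_complex_measure Y mixture"
  using complex_measure_mixture
    le_less_trans[OF variation_mixture_le[OF sets.top] finite_mass]
  by (simp add: finite_complex_measure_def)

text \<open>By the standard induction on \<open>g\<close>, starting from indicators. Measurability and inequality are proved
  together because the additivity of the outer integral in the inductive steps uses measurability of
  the inner one.\<close>

lemma
  assumes "g \<in> borel_measurable Y"
  shows nn_integral_kernel_measurable:
      "(\<lambda>z. \<integral>\<^sup>+y. g y \<partial>total_variation Y (K z)) \<in> borel_measurable X"
    and nn_integral_mixture_le: "(\<integral>\<^sup>+y. g y \<partial>total_variation Y mixture)
      \<le> (\<integral>\<^sup>+z. (\<integral>\<^sup>+y. g y \<partial>total_variation Y (K z)) \<partial>total_variation X \<rho>)"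
proof -
  have "(\<lambda>z. \<integral>\<^sup>+y. g y \<partial>total_variation Y (K z)) \<in> borel_measurable X \<and>
    (\<integral>\<^sup>+y. g y \<partial>total_variation Y mixture)
      \<le> (\<integral>\<^sup>+z. (\<integral>\<^sup>+y. g y \<partial>total_variation Y (K z)) \<partial>total_variation X \<rho>)"
    using assms
  proof (induction rule: borel_measurable_induct)
    case (cong f g)
    have "(\<integral>\<^sup>+y. f y \<partial>total_variation Y \<kappa>) = (\<integral>\<^sup>+y. g y \<partial>total_variation Y \<kappa>)" for \<kappa>
      by (rule nn_integral_cong) (simp add: cong.hyps(3))
    then show ?case using cong by simp
  next
    case (set A)
    then show ?case using variation_mixture_le[OF set] by simp
  next
    case (mult u c)
    then show ?case by (auto simp: nn_integral_cmult intro!: mult_left_mono)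
  next
    case (add u v)
    then show ?case by (auto simp: nn_integral_add intro!: add_mono)
  next
    case (seq U)
    have [measurable]: "U i \<in> borel_measurable Y" for i by (rule seq)
    have meas[measurable]: "(\<lambda>z. \<integral>\<^sup>+y. U i y \<partial>total_variation Y (K z)) \<in> borel_measurable X" for i
      using seq.IH by blast
    have SUP: "(\<integral>\<^sup>+y. (SUP i. U i) y \<partial>total_variation Y \<kappa>)
        = (SUP i. \<integral>\<^sup>+y. U i y \<partial>total_variation Y \<kappa>)" for \<kappa>
      unfolding SUP_apply by (rule nn_integral_monotone_convergence_SUP) (use seq in auto)
    have "(SUP i. \<integral>\<^sup>+y. U i y \<partial>total_variation Y mixture)
        \<le> (SUP i. \<integral>\<^sup>+z. (\<integral>\<^sup>+y. U i y \<partial>total_variation Y (K z)) \<partial>total_variation X \<rho>)"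
      using seq.IH by (intro SUP_mono) blast
    also have "\<dots> = (\<integral>\<^sup>+z. (SUP i. \<integral>\<^sup>+y. U i y \<partial>total_variation Y (K z)) \<partial>total_variation X \<rho>)"
      by (rule nn_integral_monotone_convergence_SUP[symmetric])
        (use \<open>incseq U\<close> in \<open>auto simp: incseq_def le_fun_def intro!: nn_integral_mono\<close>)
    finally show ?case unfolding SUP by simp
  qed
  then show "(\<lambda>z. \<integral>\<^sup>+y. g y \<partial>total_variation Y (K z)) \<in> borel_measurable X"
    and "(\<integral>\<^sup>+y. g y \<partial>total_variation Y mixture)
      \<le> (\<integral>\<^sup>+z. (\<integral>\<^sup>+y. g y \<partial>total_variation Y (K z)) \<partial>total_variation X \<rho>)" by auto
qed

text \<open>Fubini for mixtures. For simple functions this is linearity and the definition of the mixture; the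
  general case follows by dominated convergence, against \<open>|\<nu>|\<close>, against \<open>|K(z, \<cdot>)|\<close> for almost every
  \<open>z\<close>, and against \<open>|\<rho>|\<close>. The inner integral enters through a measurable version \<open>G\<close> because it is
  under control only for almost every \<open>z\<close>: if \<open>g\<close> is not integrable against \<open>|K(z, \<cdot>)|\<close>, then its
  value is a default value.\<close>

theorem complex_integral_mixture:
  assumes g[measurable]: "g \<in> borel_measurable Y"
    and fin: "(\<integral>\<^sup>+z. (\<integral>\<^sup>+y. norm (g y) \<partial>total_variation Y (K z)) \<partial>total_variation X \<rho>) < \<infinity>"
    and G[measurable]: "G \<in> borel_measurable X"
    and G_eq: "AE z in total_variation X \<rho>. G z = complex_integral Y (K z) g"
  shows "complex_integral Y mixture g = complex_integral X \<rho> G"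
proof -
  interpret mix: finite_complex_measure Y mixture by (rule finite_complex_measure_mixture)
  obtain F where F: "\<And>i. simple_function Y (F i)"
    "\<And>x. x \<in> space Y \<Longrightarrow> (\<lambda>i. F i x) \<longlonglongrightarrow> g x"
    "\<And>i x. x \<in> space Y \<Longrightarrow> norm (F i x) \<le> 2 * norm (g x)"
    using borel_measurable_implies_sequence_metric[OF g, of 0] by (auto simp: dist_norm) metis
  have [measurable]: "F i \<in> borel_measurable Y" for i
    by (rule borel_measurable_simple_function[OF F(1)])
  let ?E = "\<lambda>i y. F i -` {y} \<inter> space Y"
  have E[measurable]: "?E i y \<in> sets Y" for i y by (rule simple_functionD(2)[OF F(1)])
  define I where "I i z = (\<Sum>y\<in>F i ` space Y. y * K z (?E i y))" for i z
  have [measurable]: "I i \<in> borel_measurable X" for i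
    unfolding I_def[abs_def] by measurable
  let ?w = "\<lambda>z. \<integral>\<^sup>+y. norm (g y) \<partial>total_variation Y (K z)"
  have w[measurable]: "?w \<in> borel_measurable X" by (rule nn_integral_kernel_measurable) simp
  have w_fin: "AE z in total_variation X \<rho>. ?w z \<noteq> \<infinity>"
    by (rule nn_integral_PInf_AE) (use fin in auto)
  have F_eq: "complex_integral Y mixture (F i) = complex_integral X \<rho> (I i)" for i
    unfolding I_def mix.complex_integral_simple_function[OF F(1)]
    by (subst complex_integral_sum)
      (auto intro!: integrable_mult_right integrable_kernel simp: complex_integral_cmult mixture_def)
  have "(\<lambda>i. complex_integral Y mixture (F i)) \<longlonglongrightarrow> complex_integral Y mixture g"
  proof (rule mix.complex_integral_dominated_convergence)
    show "integrable (total_variation Y mixture) (\<lambda>y. 2 * norm (g y))"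
      using le_less_trans[OF nn_integral_mixture_le fin]
      by (intro integrable_mult_right integrable_norm integrableI_bounded) auto
  qed (use F in \<open>auto intro!: AE_I2\<close>)
  moreover have "(\<lambda>i. complex_integral X \<rho> (I i)) \<longlonglongrightarrow> complex_integral X \<rho> G"
  proof (rule complex_integral_dominated_convergence)
    show "integrable (total_variation X \<rho>) (\<lambda>z. 2 * enn2real (?w z))"
      by (intro integrable_mult_right integrable_enn2real) (use fin in auto)
    show "AE z in total_variation X \<rho>. (\<lambda>i. I i z) \<longlonglongrightarrow> G z"
      using AE_finite_complex_measure_kernel w_fin G_eq
    proof eventually_elim
      case (elim z)
      interpret Kz: finite_complex_measure Y "K z" by (rule elim)
      have "(\<lambda>i. complex_integral Y (K z) (F i)) \<longlonglongrightarrow> complex_integral Y (K z) g"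
      proof (rule Kz.complex_integral_dominated_convergence)
        show "integrable (total_variation Y (K z)) (\<lambda>y. 2 * norm (g y))"
          using elim(2) by (intro integrable_mult_right integrable_norm integrableI_bounded) (auto simp: less_top)
      qed (use F in \<open>auto intro!: AE_I2\<close>)
      then show ?case
        unfolding I_def using elim(3) by (simp add: Kz.complex_integral_simple_function[OF F(1)])
    qed
    show "AE z in total_variation X \<rho>. norm (I i z) \<le> 2 * enn2real (?w z)" for i
      using AE_finite_complex_measure_kernel w_fin
    proof eventually_elim
      case (elim z)
      interpret Kz: finite_complex_measure Y "K z" by (rule elim)
      have "ennreal (norm (I i z)) \<le> (\<integral>\<^sup>+y. norm (F i y) \<partial>total_variation Y (K z))"
        using Kz.norm_complex_integral_le[of "F i"]
        unfolding I_def by (simp add: Kz.complex_integral_simple_function[OF F(1)])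
      also have "\<dots> \<le> (\<integral>\<^sup>+y. 2 * ennreal (norm (g y)) \<partial>total_variation Y (K z))"
      proof (rule nn_integral_mono)
        fix y assume "y \<in> space (total_variation Y (K z))"
        then have "ennreal (norm (F i y)) \<le> ennreal (2 * norm (g y))"
          by (intro ennreal_leI F(3)) simp
        then show "ennreal (norm (F i y)) \<le> 2 * ennreal (norm (g y))"
          by (simp add: ennreal_mult)
      qed
      also have "\<dots> = 2 * ?w z" by (rule nn_integral_cmult) simp
      finally have "norm (I i z) \<le> enn2real (2 * ?w z)"
        using elim(2) by (intro le_enn2real_of_ennreal_le) (auto simp: ennreal_mult_less_top less_top)
      then show ?case by (simp add: enn2real_mult)
    qed
  qed auto
  ultimately show ?thesis unfolding F_eq by (rule LIMSEQ_unique)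
qed

end

section \<open>Complex measures with a finite weighted variation\<close>

lemma borel_measurable_norm_function_l1_size:
  assumes "norm_function \<sigma> \<phi>"
  shows "(\<lambda>z. ennreal (\<phi> (l1_size z))) \<in> borel_measurable borel"
proof -
  have "mono (\<lambda>t. \<phi> (max 0 t))"
    using assms unfolding norm_function_def mono_on_def by (auto intro!: monoI)
  then have [measurable]: "(\<lambda>t. \<phi> (max 0 t)) \<in> borel_measurable borel"
    by (rule borel_measurable_mono)
  have [measurable]: "l1_size \<in> borel_measurable borel"
    unfolding l1_size_def[abs_def]
    by (intro borel_measurable_continuous_onI continuous_intros)
  have eq: "max 0 (l1_size z) = l1_size z" for z
    by (simp add: l1_size_def sum_nonneg)
  have "(\<lambda>z. ennreal (\<phi> (max 0 (l1_size z)))) \<in> borel_measurable borel" by measurable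
  then show ?thesis by (simp only: eq)
qed

text \<open>A norm function is bounded below by \<open>\<phi>(0) > 0\<close>; this is why weighted finiteness implies
  finiteness.\<close>

lemma emeasure_le_weighted_variation:
  assumes "norm_function \<sigma> \<phi>"
  shows "ennreal (\<phi> 0) * emeasure (total_variation borel \<rho>) UNIV \<le> weighted_variation \<phi> \<rho>"
proof -
  have "ennreal (\<phi> 0) * emeasure (total_variation borel \<rho>) UNIV
      = (\<integral>\<^sup>+z. ennreal (\<phi> 0) \<partial>total_variation borel \<rho>)" by simp
  also have "\<dots> \<le> weighted_variation \<phi> \<rho>"
    unfolding weighted_variation_def using assms
    by (intro nn_integral_mono ennreal_leI)
      (auto simp: norm_function_def mono_on_def l1_size_def sum_nonneg)
  finally show ?thesis .
qed

lemma norm_function_pos: "norm_function \<sigma> \<phi> \<Longrightarrow> 0 \<le> t \<Longrightarrow> 0 < \<phi> t"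
  by (simp add: norm_function_def)

lemma finite_complex_measure_of_weighted_variation:
  assumes "complex_measure borel \<rho>" "norm_function \<sigma> \<phi>" "weighted_variation \<phi> \<rho> < \<infinity>"
  shows "finite_complex_measure borel \<rho>"
  using le_less_trans[OF emeasure_le_weighted_variation[OF assms(2)] assms(3)] assms(1)
    norm_function_pos[OF assms(2), of 0]
  by (auto simp: finite_complex_measure_def ennreal_mult_less_top)

text \<open>The complement of the support is the union of all open null sets, and a union of countably many
  null sets of a basis suffices to cover it.\<close>

lemma AE_complex_measure_support:
  fixes \<rho> :: "'a::second_countable_topology set \<Rightarrow> complex"
  shows "AE z in total_variation borel \<rho>. z \<in> complex_measure_support \<rho>"
proof -
  obtain \<B> :: "'a set set" where \<B>: "countable \<B>" "topological_basis \<B>"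
    using ex_countable_basis by blast
  let ?N = "{U \<in> \<B>. emeasure (total_variation borel \<rho>) U = 0}"
  have "(\<Union>U\<in>?N. U) \<in> null_sets (total_variation borel \<rho>)"
  proof (rule null_sets_UN')
    show "countable ?N" using \<B>(1) by (rule countable_subset[rotated]) blast
    show "U \<in> null_sets (total_variation borel \<rho>)" if "U \<in> ?N" for U
      using that topological_basis_open[OF \<B>(2)] by (auto simp: null_sets_def)
  qed
  moreover have "z \<in> (\<Union>U\<in>?N. U)" if "z \<notin> complex_measure_support \<rho>" for z
  proof -
    obtain U where U: "open U" "z \<in> U" "emeasure (total_variation borel \<rho>) U = 0"
      using \<open>z \<notin> _\<close> by (auto simp: complex_measure_support_def)
    obtain B where B: "B \<in> \<B>" "z \<in> B" "B \<subseteq> U" using topological_basisE[OF \<B>(2) U(1,2)] .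
    have "emeasure (total_variation borel \<rho>) B \<le> emeasure (total_variation borel \<rho>) U"
      using B U(1) by (intro emeasure_mono) auto
    then have "B \<in> ?N" using B(1) U(3) by simp
    then show ?thesis using B(2) by blast
  qed
  ultimately show ?thesis by (intro AE_I'[of "\<Union>U\<in>?N. U"]) auto
qed

lemma complex_radon_measure_of_finite:
  fixes \<rho> :: "'a::polish_space set \<Rightarrow> complex"
  assumes "finite_complex_measure borel \<rho>"
  shows "complex_radon_measure \<rho>"
proof -
  interpret finite_complex_measure borel \<rho> by (rule assms)
  show ?thesis
    unfolding complex_radon_measure_def
  proof (intro conjI ballI complex_measure)
    fix B :: "'a set" assume "B \<in> sets borel"
    then show "emeasure (total_variation borel \<rho>) B =
        (SUP K\<in>{K. K \<subseteq> B \<and> compact K}. emeasure (total_variation borel \<rho>) K)"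
      by (intro inner_regular) (simp_all add: tv.emeasure_finite)
  qed
qed

section \<open>Change of the activation function\<close>

text \<open>On the unit cube \<open>|w \<cdot> x| \<le> \<parallel>w\<parallel>\<^sub>1\<close>, and \<open>\<phi>\<close> is non-decreasing. The constant does not depend on
  \<open>x\<close> or \<open>z\<close>.\<close>

lemma norm_activation_le:
  assumes \<phi>: "norm_function \<sigma> \<phi>"
  obtains C where "C > 0"
    "\<And>x z. x \<in> unit_cube \<Longrightarrow> norm (\<sigma> (fst z \<bullet> x + snd z)) \<le> C * \<phi> (l1_size z)"
proof -
  obtain C where C: "C > 0" "\<And>t. norm (\<sigma> t) \<le> C * \<phi> \<bar>t\<bar>" and mono: "mono_on {0..} \<phi>"
    using \<phi> unfolding norm_function_def by blast
  have "norm (\<sigma> (fst z \<bullet> x + snd z)) \<le> C * \<phi> (l1_size z)" if x: "x \<in> unit_cube" for x z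
  proof -
    have "\<bar>fst z $ i * x $ i\<bar> \<le> \<bar>fst z $ i\<bar>" for i
    proof -
      have "\<bar>x $ i\<bar> \<le> 1" using x unfolding unit_cube_def mem_Collect_eq by (metis abs_of_pos less_imp_le)
      then show ?thesis unfolding abs_mult by (rule mult_left_le) simp
    qed
    then have "\<bar>fst z \<bullet> x\<bar> \<le> (\<Sum>i\<in>UNIV. \<bar>fst z $ i\<bar>)"
      unfolding inner_vec_def by (auto intro!: order_trans[OF sum_abs] sum_mono)
    then have "\<bar>fst z \<bullet> x + snd z\<bar> \<le> l1_size z" by (simp add: l1_size_def)
    then have "\<phi> \<bar>fst z \<bullet> x + snd z\<bar> \<le> \<phi> (l1_size z)" by (intro mono_onD[OF mono]) auto
    then show ?thesis using C by (meson mult_left_mono less_imp_le order_trans)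
  qed
  with C(1) show thesis by (rule that)
qed

lemma borel_measurable_activation_affine:
  assumes "activation \<sigma>"
  shows "(\<lambda>z :: (real^'d) \<times> real. \<sigma> (fst z \<bullet> x + snd z)) \<in> borel_measurable borel"
proof -
  have "(\<lambda>z :: (real^'d) \<times> real. fst z \<bullet> x + snd z) \<in> borel_measurable borel"
    by (intro borel_measurable_continuous_onI continuous_intros)
  from measurable_compose[OF this] show ?thesis
    using assms by (simp add: activation_def)
qed

lemma network_eq:
  "network \<sigma> \<rho> x = complex_integral borel \<rho> (\<lambda>z. \<sigma> (fst z \<bullet> x + snd z))"
  by (simp add: network_def case_prod_beta')

text \<open>The measure \<open>\<nu>\<close> is the mixture of the kernel from (A) along \<open>\<rho>\<close>; the Fubini formula applies with
  \<open>G(w, b) = \<sigma>\<^sub>2(w \<cdot> x + b)\<close>, which is measurable and equals the inner integral on the support.\<close>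

proposition change_of_activation:
  fixes f :: "real^'d \<Rightarrow> complex"
  assumes act: "activation \<sigma>1" "activation \<sigma>2"
    and \<phi>1: "norm_function \<sigma>1 \<phi>1" and \<phi>2: "norm_function \<sigma>2 \<phi>2"
    and A: "assumptions_A unit_cube \<sigma>1 \<phi>1 \<sigma>2 \<phi>2 f \<rho> M"
  obtains \<nu> where "complex_radon_measure \<nu>" "\<forall>x\<in>unit_cube. f x = network \<sigma>1 \<nu> x"
    "weighted_variation \<phi>1 \<nu> \<le> ennreal M * weighted_variation \<phi>2 \<rho>"
    "weighted_variation \<phi>1 \<nu> < \<infinity>"
proof -
  let ?T = "total_variation borel \<rho>"
  let ?L = "\<lambda>z :: (real^'d) \<times> real. \<phi>1 (l1_size z)"
  have [measurable]: "(\<lambda>z. ennreal (?L z)) \<in> borel_measurable borel"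
    "(\<lambda>z :: (real^'d) \<times> real. ennreal (\<phi>2 (l1_size z))) \<in> borel_measurable borel"
    using borel_measurable_norm_function_l1_size[OF \<phi>1]
      borel_measurable_norm_function_l1_size[OF \<phi>2] by auto
  from A obtain K where M: "M > 0" and f: "\<And>x. x \<in> unit_cube \<Longrightarrow> f x = network \<sigma>2 \<rho> x"
    and \<rho>: "complex_measure borel \<rho>" "weighted_variation \<phi>2 \<rho> < \<infinity>"
    and K: "complex_kernel borel borel K"
    and K_eq: "\<And>z x. z \<in> complex_measure_support \<rho> \<Longrightarrow> x \<in> unit_cube \<Longrightarrow>
        \<sigma>2 (fst z \<bullet> x + snd z) = network \<sigma>1 (K z) x"
    and K_le: "\<And>z. z \<in> complex_measure_support \<rho> \<Longrightarrow>
        weighted_variation \<phi>1 (K z) \<le> ennreal (M * \<phi>2 (l1_size z))"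
    unfolding assumptions_A_def weighted_measures_def complex_radon_measure_def by fastforce
  have M\<rho>: "ennreal M * weighted_variation \<phi>2 \<rho> < \<infinity>"
    using \<rho>(2) by (simp add: ennreal_mult_less_top)
  \<comment> \<open>Assumption (iii) integrated against \<open>|\<rho>|\<close>; all integrability below comes from this bound.\<close>
  have weighted: "(\<integral>\<^sup>+z. weighted_variation \<phi>1 (K z) \<partial>?T) \<le> ennreal M * weighted_variation \<phi>2 \<rho>"
  proof -
    have "(\<integral>\<^sup>+z. weighted_variation \<phi>1 (K z) \<partial>?T) \<le> (\<integral>\<^sup>+z. ennreal M * ennreal (\<phi>2 (l1_size z)) \<partial>?T)"
      using AE_complex_measure_support[of \<rho>] K_le M
      by (intro nn_integral_mono_AE) (auto simp: ennreal_mult')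
    also have "\<dots> = ennreal M * weighted_variation \<phi>2 \<rho>"
      unfolding weighted_variation_def by (rule nn_integral_cmult) simp
    finally show ?thesis .
  qed
  interpret \<rho>: finite_complex_measure borel \<rho>
    by (rule finite_complex_measure_of_weighted_variation[OF \<rho>(1) \<phi>2 \<rho>(2)])
  interpret kernel_mixture borel \<rho> borel K
  proof
    have [measurable]: "(\<lambda>z. emeasure (total_variation borel (K z)) UNIV) \<in> borel_measurable borel"
      using K by (auto simp: complex_kernel_def)
    have "ennreal (\<phi>1 0) * (\<integral>\<^sup>+z. emeasure (total_variation borel (K z)) UNIV \<partial>?T)
        = (\<integral>\<^sup>+z. ennreal (\<phi>1 0) * emeasure (total_variation borel (K z)) UNIV \<partial>?T)"
      by (rule nn_integral_cmult[symmetric]) simp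
    also have "\<dots> \<le> (\<integral>\<^sup>+z. weighted_variation \<phi>1 (K z) \<partial>?T)"
      by (intro nn_integral_mono emeasure_le_weighted_variation[OF \<phi>1])
    also note weighted
    finally have "ennreal (\<phi>1 0) * (\<integral>\<^sup>+z. emeasure (total_variation borel (K z)) UNIV \<partial>?T) < \<infinity>"
      using M\<rho> by (rule le_less_trans)
    then show "(\<integral>\<^sup>+z. emeasure (total_variation borel (K z)) (space borel) \<partial>?T) < \<infinity>"
      using norm_function_pos[OF \<phi>1, of 0] by (auto simp: ennreal_mult_less_top)
  qed (rule K)
  have le: "weighted_variation \<phi>1 mixture \<le> ennreal M * weighted_variation \<phi>2 \<rho>"
    using nn_integral_mixture_le[of "\<lambda>z. ennreal (?L z)"] weighted
    unfolding weighted_variation_def by auto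
  obtain C where C: "C > 0"
    "\<And>(x :: real^'d) z. x \<in> unit_cube \<Longrightarrow> norm (\<sigma>1 (fst z \<bullet> x + snd z)) \<le> C * \<phi>1 (l1_size z)"
    using norm_activation_le[OF \<phi>1] by blast
  have "f x = network \<sigma>1 mixture x" if x: "x \<in> unit_cube" for x
    unfolding f[OF x] network_eq[of _ _ x]
  proof (rule complex_integral_mixture[symmetric])
    have "(\<integral>\<^sup>+z. (\<integral>\<^sup>+y. norm (\<sigma>1 (fst y \<bullet> x + snd y)) \<partial>total_variation borel (K z)) \<partial>?T)
        \<le> (\<integral>\<^sup>+z. ennreal C * weighted_variation \<phi>1 (K z) \<partial>?T)"
    proof (rule nn_integral_mono)
      fix z
      have "(\<integral>\<^sup>+y. norm (\<sigma>1 (fst y \<bullet> x + snd y)) \<partial>total_variation borel (K z))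
          \<le> (\<integral>\<^sup>+y. ennreal C * ennreal (?L y) \<partial>total_variation borel (K z))"
        using C(1) C(2)[OF x] by (intro nn_integral_mono) (auto simp flip: ennreal_mult' intro!: ennreal_leI)
      also have "\<dots> = ennreal C * weighted_variation \<phi>1 (K z)"
        unfolding weighted_variation_def by (rule nn_integral_cmult) simp
      finally show "(\<integral>\<^sup>+y. norm (\<sigma>1 (fst y \<bullet> x + snd y)) \<partial>total_variation borel (K z))
          \<le> ennreal C * weighted_variation \<phi>1 (K z)" .
    qed
    also have "\<dots> = ennreal C * (\<integral>\<^sup>+z. weighted_variation \<phi>1 (K z) \<partial>?T)"
      unfolding weighted_variation_def
    proof (rule nn_integral_cmult)
      show "(\<lambda>z. \<integral>\<^sup>+y. ennreal (?L y) \<partial>total_variation borel (K z)) \<in> borel_measurable ?T"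
        using nn_integral_kernel_measurable[of "\<lambda>y. ennreal (?L y)"] by simp
    qed
    also have "\<dots> < \<infinity>"
      using le_less_trans[OF weighted M\<rho>] by (simp add: ennreal_mult_less_top)
    finally show "(\<integral>\<^sup>+z. (\<integral>\<^sup>+y. norm (\<sigma>1 (fst y \<bullet> x + snd y)) \<partial>total_variation borel (K z)) \<partial>?T)
        < \<infinity>" .
    show "AE z in ?T. \<sigma>2 (fst z \<bullet> x + snd z)
        = complex_integral borel (K z) (\<lambda>z. \<sigma>1 (fst z \<bullet> x + snd z))"
      using AE_complex_measure_support[of \<rho>] K_eq[OF _ x] by (auto simp: network_eq)
  qed (intro borel_measurable_activation_affine act)+
  then show thesis
    using that[of mixture] complex_radon_measure_of_finite[OF finite_complex_measure_mixture]
      le le_less_trans[OF le M\<rho>] by blast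
qed

section \<open>Barron spaces\<close>

lemma AE_lebesgue_on_unit_cube:
  assumes "\<forall>x\<in>unit_cube. P x"
  shows "AE x in lebesgue_on (unit_cube :: (real^'d) set). P x"
  using assms by (intro AE_I2) (auto simp: space_restrict_space)

lemma barron_norm_le: "\<nu> \<in> representing_measures \<Omega> \<sigma> \<phi> f \<Longrightarrow>
    barron_norm \<Omega> \<sigma> \<phi> f \<le> weighted_variation \<phi> \<nu>"
  unfolding barron_norm_def by (rule INF_lower)

text \<open>The assumptions (A) hold for a representative \<open>g\<close>; the measure obtained represents every other
  representative \<open>f\<close> as well.\<close>

lemma representing_measure_of_assumptions_A:
  fixes f g :: "real^'d \<Rightarrow> complex"
  assumes "activation \<sigma>1" "activation \<sigma>2" "norm_function \<sigma>1 \<phi>1" "norm_function \<sigma>2 \<phi>2"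
    and "assumptions_A unit_cube \<sigma>1 \<phi>1 \<sigma>2 \<phi>2 g \<rho> M"
    and fg: "AE x in lebesgue_on unit_cube. g x = f x"
  obtains \<nu> where "\<nu> \<in> representing_measures unit_cube \<sigma>1 \<phi>1 f"
    "weighted_variation \<phi>1 \<nu> \<le> ennreal M * weighted_variation \<phi>2 \<rho>"
proof -
  obtain \<nu> where \<nu>: "complex_radon_measure \<nu>" "\<forall>x\<in>unit_cube. g x = network \<sigma>1 \<nu> x"
    "weighted_variation \<phi>1 \<nu> \<le> ennreal M * weighted_variation \<phi>2 \<rho>"
    "weighted_variation \<phi>1 \<nu> < \<infinity>"
    using change_of_activation[OF assms(1-5)] by blast
  have "AE x in lebesgue_on unit_cube. f x = network \<sigma>1 \<nu> x"
    using AE_lebesgue_on_unit_cube[OF \<nu>(2)] fg by eventually_elim simp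
  then show thesis
    using that \<nu> by (auto simp: representing_measures_def weighted_measures_def)
qed

text \<open>Each \<open>\<rho>\<^sub>n\<close> bounds the \<open>\<sigma>\<^sub>1\<close>-norm by \<open>M\<close> times its weighted variation, and these converge to
  the \<open>\<sigma>\<^sub>2\<close>-norm.\<close>

proposition barron_norm_le_of_admissible_sequence:
  fixes f :: "real^'d \<Rightarrow> complex"
  assumes hyps: "activation \<sigma>1" "activation \<sigma>2" "norm_function \<sigma>1 \<phi>1" "norm_function \<sigma>2 \<phi>2"
    and f: "f \<in> barron_space unit_cube \<sigma>2 \<phi>2"
    and adm: "admissible_sequence unit_cube \<sigma>1 \<phi>1 \<sigma>2 \<phi>2 f \<rho> M"
  shows "f \<in> barron_space unit_cube \<sigma>1 \<phi>1"
    and "barron_norm unit_cube \<sigma>1 \<phi>1 f \<le> ennreal M * barron_norm unit_cube \<sigma>2 \<phi>2 f"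
proof -
  have "\<exists>\<nu>\<in>representing_measures unit_cube \<sigma>1 \<phi>1 f.
      weighted_variation \<phi>1 \<nu> \<le> ennreal M * weighted_variation \<phi>2 (\<rho> n)" for n
  proof -
    obtain g where g: "AE x in lebesgue_on unit_cube. g x = f x"
      "assumptions_A unit_cube \<sigma>1 \<phi>1 \<sigma>2 \<phi>2 g (\<rho> n) M"
      using adm[unfolded admissible_sequence_def, THEN conjunct2, THEN conjunct2, THEN spec, of n]
      by (elim exE conjE)
    show ?thesis
      by (rule representing_measure_of_assumptions_A[OF hyps g(2,1)]) blast
  qed
  then obtain \<nu> where \<nu>: "\<And>n. \<nu> n \<in> representing_measures unit_cube \<sigma>1 \<phi>1 f"
    "\<And>n. weighted_variation \<phi>1 (\<nu> n) \<le> ennreal M * weighted_variation \<phi>2 (\<rho> n)"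
    by metis
  have "(\<lambda>n. weighted_variation \<phi>2 (\<rho> n)) \<longlonglongrightarrow> barron_norm unit_cube \<sigma>2 \<phi>2 f"
    using adm unfolding admissible_sequence_def by (elim conjE)
  then have "(\<lambda>n. ennreal M * weighted_variation \<phi>2 (\<rho> n))
      \<longlonglongrightarrow> ennreal M * barron_norm unit_cube \<sigma>2 \<phi>2 f"
    by (rule ennreal_tendsto_cmult[OF ennreal_less_top])
  moreover have "\<forall>n\<ge>0. barron_norm unit_cube \<sigma>1 \<phi>1 f \<le> ennreal M * weighted_variation \<phi>2 (\<rho> n)"
    by (intro allI impI order_trans[OF barron_norm_le[OF \<nu>(1)] \<nu>(2)])
  ultimately show "barron_norm unit_cube \<sigma>1 \<phi>1 f \<le> ennreal M * barron_norm unit_cube \<sigma>2 \<phi>2 f"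
    by (rule LIMSEQ_le_const[OF _ exI])
  show "f \<in> barron_space unit_cube \<sigma>1 \<phi>1"
    using f \<nu>(1)[of 0] by (auto simp: barron_space_def)
qed

text \<open>The infimum over the empty set is \<open>\<infinity>\<close>, so a finite norm provides a representing measure of the
  difference.\<close>

lemma diff_in_barron_space:
  assumes "f \<in> barron_space \<Omega> \<sigma> \<phi>" "g \<in> barron_space \<Omega> \<sigma> \<phi>"
    and fin: "barron_norm \<Omega> \<sigma> \<phi> (\<lambda>x. g x - f x) < \<infinity>"
  shows "(\<lambda>x. g x - f x) \<in> barron_space \<Omega> \<sigma> \<phi>"
proof -
  have "representing_measures \<Omega> \<sigma> \<phi> (\<lambda>x. g x - f x) \<noteq> {}"
    using fin unfolding barron_norm_def by (rule contrapos_pn) simp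
  then show ?thesis
    using assms(1,2) unfolding barron_space_def mem_Collect_eq
    by (intro conjI borel_measurable_diff) simp_all
qed

lemma continuously_embedded_barron_space:
  assumes sub: "barron_space \<Omega> \<sigma>2 \<phi>2 \<subseteq> barron_space \<Omega> \<sigma>1 \<phi>1"
    and bound: "\<And>f. f \<in> barron_space \<Omega> \<sigma>2 \<phi>2 \<Longrightarrow>
      barron_norm \<Omega> \<sigma>1 \<phi>1 f \<le> ennreal M * barron_norm \<Omega> \<sigma>2 \<phi>2 f"
  shows "continuously_embedded (barron_space \<Omega> \<sigma>2 \<phi>2) (barron_norm \<Omega> \<sigma>2 \<phi>2)
    (barron_space \<Omega> \<sigma>1 \<phi>1) (barron_norm \<Omega> \<sigma>1 \<phi>1)"
  unfolding continuously_embedded_def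
proof (intro conjI ballI allI impI sub)
  let ?n1 = "barron_norm \<Omega> \<sigma>1 \<phi>1" and ?n2 = "barron_norm \<Omega> \<sigma>2 \<phi>2"
  fix f g
  assume f: "f \<in> barron_space \<Omega> \<sigma>2 \<phi>2" and g: "\<forall>n::nat. g n \<in> barron_space \<Omega> \<sigma>2 \<phi>2"
    and lim: "(\<lambda>n. ?n2 (\<lambda>x. g n x - f x)) \<longlonglongrightarrow> 0"
  have "\<forall>\<^sub>F n in sequentially. ?n2 (\<lambda>x. g n x - f x) < \<infinity>"
    using lim by (rule order_tendstoD(2)) simp
  then have le: "\<forall>\<^sub>F n in sequentially.
      ?n1 (\<lambda>x. g n x - f x) \<le> ennreal M * ?n2 (\<lambda>x. g n x - f x)"
    by (rule eventually_mono) (intro bound diff_in_barron_space f g[rule_format])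
  show "(\<lambda>n. ?n1 (\<lambda>x. g n x - f x)) \<longlonglongrightarrow> 0"
  proof (rule tendsto_sandwich[OF _ le tendsto_const])
    show "(\<lambda>n. ennreal M * ?n2 (\<lambda>x. g n x - f x)) \<longlonglongrightarrow> 0"
      using ennreal_tendsto_cmult[OF ennreal_less_top lim, of M] by simp
  qed simp
qed

lemma embedding_norm_le:
  assumes "\<And>f. f \<in> V \<Longrightarrow> q f \<le> ennreal M * p f"
  shows "embedding_norm V p q \<le> ennreal M"
  unfolding embedding_norm_def
proof (rule SUP_least)
  fix f assume "f \<in> {f \<in> V. p f \<le> 1}"
  then have f: "f \<in> V" "p f \<le> 1" by simp_all
  note assms[OF f(1)]
  also have "ennreal M * p f \<le> ennreal M * 1" using f(2) by (rule mult_left_mono) simp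
  finally show "q f \<le> ennreal M" by simp
qed

theorem theorem2p9:
  fixes \<sigma>1 \<sigma>2 :: "real \<Rightarrow> complex" and \<phi>1 \<phi>2 :: "real \<Rightarrow> real" and \<Omega> :: "(real^'d) set"
  assumes "\<Omega> = unit_cube"
    and "activation \<sigma>1" and "activation \<sigma>2"
    and "norm_function \<sigma>1 \<phi>1" and "norm_function \<sigma>2 \<phi>2"
  shows
    "(\<forall>f \<rho> M. assumptions_A \<Omega> \<sigma>1 \<phi>1 \<sigma>2 \<phi>2 f \<rho> M \<longrightarrow>
        (\<exists>\<nu>. complex_radon_measure \<nu> \<and> (\<forall>x\<in>\<Omega>. f x = network \<sigma>1 \<nu> x) \<and>
             weighted_variation \<phi>1 \<nu> \<le> ennreal M * weighted_variation \<phi>2 \<rho>) \<and>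
        f \<in> barron_space \<Omega> \<sigma>1 \<phi>1 \<and>
        barron_norm \<Omega> \<sigma>1 \<phi>1 f \<le> ennreal M * weighted_variation \<phi>2 \<rho>) \<and>
     (\<forall>f \<rho> M. f \<in> barron_space \<Omega> \<sigma>2 \<phi>2 \<longrightarrow> admissible_sequence \<Omega> \<sigma>1 \<phi>1 \<sigma>2 \<phi>2 f \<rho> M \<longrightarrow>
        barron_norm \<Omega> \<sigma>1 \<phi>1 f \<le> ennreal M * barron_norm \<Omega> \<sigma>2 \<phi>2 f) \<and>
     (\<forall>M. (\<forall>f\<in>barron_space \<Omega> \<sigma>2 \<phi>2. \<exists>\<rho>. admissible_sequence \<Omega> \<sigma>1 \<phi>1 \<sigma>2 \<phi>2 f \<rho> M) \<longrightarrow>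
        continuously_embedded (barron_space \<Omega> \<sigma>2 \<phi>2) (barron_norm \<Omega> \<sigma>2 \<phi>2)
          (barron_space \<Omega> \<sigma>1 \<phi>1) (barron_norm \<Omega> \<sigma>1 \<phi>1) \<and>
        embedding_norm (barron_space \<Omega> \<sigma>2 \<phi>2) (barron_norm \<Omega> \<sigma>2 \<phi>2) (barron_norm \<Omega> \<sigma>1 \<phi>1)
          \<le> ennreal M)"
  unfolding \<open>\<Omega> = unit_cube\<close>
proof (intro conjI allI impI)
  fix f \<rho> M
  assume A: "assumptions_A unit_cube \<sigma>1 \<phi>1 \<sigma>2 \<phi>2 (f :: real^'d \<Rightarrow> complex) \<rho> M"
  show "\<exists>\<nu>. complex_radon_measure \<nu> \<and> (\<forall>x\<in>unit_cube. f x = network \<sigma>1 \<nu> x) \<and>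
      weighted_variation \<phi>1 \<nu> \<le> ennreal M * weighted_variation \<phi>2 \<rho>"
    by (rule change_of_activation[OF assms(2-5) A]) blast
  obtain \<nu> where \<nu>: "\<nu> \<in> representing_measures unit_cube \<sigma>1 \<phi>1 f"
    "weighted_variation \<phi>1 \<nu> \<le> ennreal M * weighted_variation \<phi>2 \<rho>"
    by (rule representing_measure_of_assumptions_A[OF assms(2-5) A AE_I2[OF refl]])
  have "f \<in> barron_space unit_cube \<sigma>2 \<phi>2"
    using A unfolding assumptions_A_def by (rule conjunct1)
  then show "f \<in> barron_space unit_cube \<sigma>1 \<phi>1" using \<nu>(1) by (auto simp: barron_space_def)
  show "barron_norm unit_cube \<sigma>1 \<phi>1 f \<le> ennreal M * weighted_variation \<phi>2 \<rho>"
    using barron_norm_le[OF \<nu>(1)] \<nu>(2) by (rule order_trans)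
next
  fix f \<rho> M
  assume "(f :: real^'d \<Rightarrow> complex) \<in> barron_space unit_cube \<sigma>2 \<phi>2"
    "admissible_sequence unit_cube \<sigma>1 \<phi>1 \<sigma>2 \<phi>2 f \<rho> M"
  then show "barron_norm unit_cube \<sigma>1 \<phi>1 f \<le> ennreal M * barron_norm unit_cube \<sigma>2 \<phi>2 f"
    by (rule barron_norm_le_of_admissible_sequence(2)[OF assms(2-5)])
next
  let ?B1 = "barron_space (unit_cube :: (real^'d) set) \<sigma>1 \<phi>1"
  let ?B2 = "barron_space (unit_cube :: (real^'d) set) \<sigma>2 \<phi>2"
  fix M assume adm: "\<forall>f\<in>?B2. \<exists>\<rho>. admissible_sequence unit_cube \<sigma>1 \<phi>1 \<sigma>2 \<phi>2 f \<rho> M"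
  have sub: "f \<in> ?B1"
    and bound: "barron_norm unit_cube \<sigma>1 \<phi>1 f \<le> ennreal M * barron_norm unit_cube \<sigma>2 \<phi>2 f"
    if f: "f \<in> ?B2" for f
  proof -
    obtain \<rho> where "admissible_sequence unit_cube \<sigma>1 \<phi>1 \<sigma>2 \<phi>2 f \<rho> M"
      using bspec[OF adm f] by (rule exE)
    note barron_norm_le_of_admissible_sequence[OF assms(2-5) f this]
    then show "f \<in> ?B1" "barron_norm unit_cube \<sigma>1 \<phi>1 f \<le> ennreal M * barron_norm unit_cube \<sigma>2 \<phi>2 f"
      by this+
  qed
  show "continuously_embedded ?B2 (barron_norm unit_cube \<sigma>2 \<phi>2) ?B1 (barron_norm unit_cube \<sigma>1 \<phi>1)"
    by (rule continuously_embedded_barron_space[OF subsetI]) (erule sub bound)+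
  show "embedding_norm ?B2 (barron_norm unit_cube \<sigma>2 \<phi>2) (barron_norm unit_cube \<sigma>1 \<phi>1)
      \<le> ennreal M"
    by (rule embedding_norm_le) (rule bound)
qed

end
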